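(* Let $\{\mathcal{T}(t)\}_{t\ge 0}$ be the symmetric telegraph process with speed $c>0$ and rate $\lambda>0$, and let $t>0$. For all integers $m\ge 1$ and $k\ge 0$, $$\mathbb{E}\Bigl[ \bigl(\max_{0\le s\le t} \mathcal{T}(s)\bigr)^m \,\Big|\, V(0) = c,\ N(t) = 2k+1\Bigr] = \mathbb{E}\Bigl[ \bigl(\max_{0\le s\le t} \mathcal{T}(s)\bigr)^m \,\Big|\, V(0) = c,\ N(t) = 2k+2\Bigr] = \frac{(2k+1)!\,(ct)^m}{2^{2k+1}\,k!}\, \frac{\Gamma\bigl(\frac{m+1}{2}\bigr)}{\Gamma\bigl(k+1+\frac{m+1}{2}\bigr)} .$$ In particular, $$\mathbb{E}\Bigl[ \max_{0\le s\le t} \mathcal{T}(s) \,\Big|\, V(0) = c,\ N(t) = 2k+1\Bigr] = \binom{2k+1}{k}\frac{ct}{2^{2k+1}},\qquad \mathbb{E}\Bigl[ \bigl(\max_{0\le s\le t} \mathcal{T}(s)\bigr)^2 \,\Big|\, V(0) = c,\ N(t) = 2k+1\Bigr] = \frac{c^2t^2}{2k+3} .$$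
   Context: Let $c>0$, $\lambda>0$. Let $V(0)$ be a random variable with $P\{V(0)=c\}=P\{V(0)=-c\}=\tfrac12$ and let $\{N(t)\}_{t\ge0}$ be a homogeneous Poisson process with rate $\lambda$, independent of $V(0)$. The symmetric telegraph process is $\mathcal{T}(t)=\int_0^t V(0)(-1)^{N(s)}\,ds$, $t\ge 0$ (so $\mathcal{T}(0)=0$). $\Gamma$ is the Euler gamma function. *)

theory Defs
  imports "HOL-Probability.Probability"
begin

text \<open>Sample paths are required to be nondecreasing and right-continuous for every outcome; the
  values \<open>N s\<close> for \<open>s < 0\<close> are irrelevant.  Since paths are nondecreasing, the truncated
  subtraction on \<^typ>\<open>nat\<close> below is the true increment.\<close>

locale poisson_process = prob_space M for M :: "'a measure" +
  fixes rate :: real and N :: "real \<Rightarrow> 'a \<Rightarrow> nat"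
  assumes rate_pos: "rate > 0"
    and random_variable_N: "\<And>s. s \<ge> 0 \<Longrightarrow> random_variable (count_space UNIV) (N s)"
    and N_zero: "\<And>\<omega>. \<omega> \<in> space M \<Longrightarrow> N 0 \<omega> = 0"
    and N_mono: "\<And>\<omega> r s. \<omega> \<in> space M \<Longrightarrow> 0 \<le> r \<Longrightarrow> r \<le> s \<Longrightarrow> N r \<omega> \<le> N s \<omega>"
    and N_right_continuous:
      "\<And>\<omega> s. \<omega> \<in> space M \<Longrightarrow> s \<ge> 0 \<Longrightarrow> ((\<lambda>u. N u \<omega>) \<longlongrightarrow> N s \<omega>) (at_right s)"
    and independent_increments:
      "\<And>(n::nat) \<tau>. 0 \<le> \<tau> 0 \<Longrightarrow> (\<And>i. i < n \<Longrightarrow> \<tau> i \<le> \<tau> (Suc i)) \<Longrightarrow>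
         indep_vars (\<lambda>_. count_space UNIV) (\<lambda>i \<omega>. N (\<tau> (Suc i)) \<omega> - N (\<tau> i) \<omega>) {..<n}"
    and poisson_increments:
      "\<And>r s. 0 \<le> r \<Longrightarrow> r < s \<Longrightarrow>
         distr M (count_space UNIV) (\<lambda>\<omega>. N s \<omega> - N r \<omega>) = measure_pmf (poisson_pmf (rate * (s - r)))"

text \<open>Independence of \<open>V0\<close> and the whole process is independence of the generated sigma-algebras;
  \<^const>\<open>prob_space.indep_var\<close> does not apply because it forces a common value type.\<close>

locale symmetric_telegraph = poisson_process M rate N
  for M :: "'a measure" and rate :: real and N :: "real \<Rightarrow> 'a \<Rightarrow> nat" +
  fixes c :: real and V0 :: "'a \<Rightarrow> real"
  assumes c_pos: "c > 0"
    and random_variable_V0: "random_variable borel V0"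
    and prob_V0_pos: "prob {\<omega> \<in> space M. V0 \<omega> = c} = 1 / 2"
    and prob_V0_neg: "prob {\<omega> \<in> space M. V0 \<omega> = - c} = 1 / 2"
    and indep_V0_N:
      "indep_set (sets (vimage_algebra (space M) V0 borel))
         (sets (vimage_algebra (space M) (\<lambda>\<omega>. \<lambda>s\<in>{0..}. N s \<omega>)
                  (\<Pi>\<^sub>M s\<in>{0::real..}. count_space (UNIV :: nat set))))"

definition telegraph :: "('a \<Rightarrow> real) \<Rightarrow> (real \<Rightarrow> 'a \<Rightarrow> nat) \<Rightarrow> real \<Rightarrow> 'a \<Rightarrow> real" where
  "telegraph V0 N t \<omega> = integral {0..t} (\<lambda>s. V0 \<omega> * (-1) ^ N s \<omega>)"

text \<open>For telegraph paths the supremum is a maximum; see \<open>telegraph_maximum_attained\<close> below.\<close>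

definition running_max :: "(real \<Rightarrow> 'a \<Rightarrow> real) \<Rightarrow> real \<Rightarrow> 'a \<Rightarrow> real" where
  "running_max X t \<omega> = (SUP s\<in>{0..t}. X s \<omega>)"

definition event_expectation :: "'a measure \<Rightarrow> ('a \<Rightarrow> real) \<Rightarrow> ('a \<Rightarrow> bool) \<Rightarrow> real" where
  "event_expectation M X A =
     (LINT \<omega>:{\<omega> \<in> space M. A \<omega>}|M. X \<omega>) / measure M {\<omega> \<in> space M. A \<omega>}"

context poisson_process
begin

lemma telegraph_integrable:
  fixes V0 :: "'a \<Rightarrow> real"
  assumes "\<omega> \<in> space M"
  shows "(\<lambda>s. V0 \<omega> * (-1) ^ N s \<omega>) integrable_on {0..t}"
proof -
  let ?g = "\<lambda>s. V0 \<omega> * cos (real (N (max 0 s) \<omega>) * pi)"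
  have "mono (\<lambda>s. real (N (max 0 s) \<omega>))"
    by (rule monoI) (use N_mono[OF assms] in auto)
  then have [measurable]: "(\<lambda>s. real (N (max 0 s) \<omega>)) \<in> borel_measurable borel"
    by (rule borel_measurable_mono)
  have "?g \<in> borel_measurable lborel"
    by measurable
  then have "set_integrable lborel {0..t} ?g"
    unfolding set_integrable_def
    by (intro integrableI_bounded_set_indicator[where B = "\<bar>V0 \<omega>\<bar>"])
       (auto simp: abs_mult mult_left_le emeasure_lborel_Icc_eq simp del: cos_npi)
  then have "?g integrable_on {0..t}"
    by (rule set_borel_integral_eq_integral)
  then show ?thesis
    by (rule integrable_eq) (auto simp: max_def)
qed

lemma telegraph_maximum_attained:
  assumes "\<omega> \<in> space M" "t \<ge> 0"
  shows "\<exists>s\<in>{0..t}. telegraph V0 N s \<omega> = running_max (telegraph V0 N) t \<omega> \<and>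
           (\<forall>r\<in>{0..t}. telegraph V0 N r \<omega> \<le> telegraph V0 N s \<omega>)"
proof -
  have "continuous_on {0..t} (\<lambda>s. telegraph V0 N s \<omega>)"
    unfolding telegraph_def
    by (rule indefinite_integral_continuous_1[OF telegraph_integrable[OF assms(1)]])
  then obtain s where s: "s \<in> {0..t}"
    "\<forall>r\<in>{0..t}. telegraph V0 N r \<omega> \<le> telegraph V0 N s \<omega>"
    using continuous_attains_sup[of "{0..t}" "\<lambda>s. telegraph V0 N s \<omega>"] assms(2) by auto
  have "running_max (telegraph V0 N) t \<omega> = telegraph V0 N s \<omega>"
    unfolding running_max_def by (rule cSup_eq_maximum) (use s in auto)
  with s show ?thesis by metis
qed

end

end

(*
Cut [0,t] into L = 2r cells and record for each cell whether the number of jumps in it is odd. Up to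
an error O(1/L) the maximum of the telegraph path is ct/L times the maximum of the lattice walk that
reverses its direction after the marked cells, and up to an event of probability O(1/L) no cell
contains two jumps. Given N(t) = n the set of marked cells is then a uniformly distributed n-subset.

The number of n-subsets for which the walk has maximum j is a product of two binomial coefficients,
essentially C((L+j)/2, k) C((L-j)/2, k) for n = 2k+1; for n = 2k+2 this shape depends on the parity
of L+j, and only the average over neighbouring j has a limit. The formulas follow from Pascal's rule
once the walks that start downwards are counted as well. The sums over j are Riemann sums, and in
the limit the m-th moment is a multiple of the integral of u^m (1 - u^2)^k over [0,1].
*)
theory Submission
  imports Defs
begin

text \<open>The conditional law of the jump times is never described directly. Independent Poisson
  increments give the probability of a whole pattern of marked cells as a finite product; divided by
  the probability of the conditioning event, it leaves the weight n!/L^n for every pattern with n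
  marks.

  The obstacle is that counting by the first step does not close on upward walks: a reversal turns
  an upward walk with n marks left into a downward one with n - 1. The counts therefore separate
  into two systems, upward odd with downward even and upward even with downward odd, and each needs
  its own closed form, with an extra one at height 0, where the maximum of a downward walk gets
  stuck.

  L is taken even so that the heights split into pairs of neighbours whose joint contribution is one
  term of a Riemann sum over r cells.\<close>

section \<open>Counting lattice walks by their maximum\<close>

text \<open>The maximum, over all times including 0, of the walk with steps \<open>+1\<close> and \<open>-1\<close> that starts
  upwards iff \<open>u\<close> holds and reverses direction after step \<open>i\<close> iff the \<open>i\<close>-th entry is true.
  The truncated subtraction in the downward case is the maximum with the starting height 0.\<close>

fun path_max :: "bool \<Rightarrow> bool list \<Rightarrow> nat" where
  "path_max u [] = 0"
| "path_max True (b # bs) = Suc (path_max (\<not> b) bs)"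
| "path_max False (b # bs) = path_max b bs - 1"

definition flip_lists :: "nat \<Rightarrow> nat \<Rightarrow> bool list set" where
  "flip_lists L n = {bs. length bs = L \<and> count_list bs True = n}"

definition num_paths :: "bool \<Rightarrow> nat \<Rightarrow> nat \<Rightarrow> nat \<Rightarrow> nat" where
  "num_paths u n L j = card {bs \<in> flip_lists L n. path_max u bs = j}"

lemma finite_flip_lists [simp]: "finite (flip_lists L n)"
proof -
  have "flip_lists L n \<subseteq> {bs. set bs \<subseteq> UNIV \<and> length bs = L}"
    by (auto simp: flip_lists_def)
  then show ?thesis
    by (rule finite_subset) (rule finite_lists_length_eq, simp)
qed

lemma path_max_le_length: "path_max u bs \<le> length bs"
proof (induction u bs rule: path_max.induct)
  case (3 b bs)
  then show ?case by (simp add: le_diff_conv)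
qed auto

lemma flip_lists_0: "flip_lists 0 n = (if n = 0 then {[]} else {})"
  by (auto simp: flip_lists_def)

lemma flip_lists_Suc_0: "flip_lists (Suc L) 0 = (#) False ` flip_lists L 0"
  by (auto simp: flip_lists_def length_Suc_conv image_iff count_list_0_iff)

lemma flip_lists_Suc_Suc:
  "flip_lists (Suc L) (Suc n) = (#) False ` flip_lists L (Suc n) \<union> (#) True ` flip_lists L n"
  by (auto simp: flip_lists_def length_Suc_conv image_iff split: if_splits)

lemma card_flip_filter_Suc_0:
  "card {bs \<in> flip_lists (Suc L) 0. P bs} = card {bs \<in> flip_lists L 0. P (False # bs)}"
proof -
  have "{bs \<in> flip_lists (Suc L) 0. P bs} = (#) False ` {bs \<in> flip_lists L 0. P (False # bs)}"
    by (auto simp: flip_lists_Suc_0)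
  then show ?thesis by (simp add: card_image)
qed

lemma card_flip_filter_Suc_Suc:
  "card {bs \<in> flip_lists (Suc L) (Suc n). P bs} =
     card {bs \<in> flip_lists L (Suc n). P (False # bs)} + card {bs \<in> flip_lists L n. P (True # bs)}"
proof -
  have "{bs \<in> flip_lists (Suc L) (Suc n). P bs} =
     (#) False ` {bs \<in> flip_lists L (Suc n). P (False # bs)} \<union>
     (#) True ` {bs \<in> flip_lists L n. P (True # bs)}"
    by (auto simp: flip_lists_Suc_Suc)
  moreover have "((#) False ` {bs \<in> flip_lists L (Suc n). P (False # bs)}) \<inter>
     ((#) True ` {bs \<in> flip_lists L n. P (True # bs)}) = {}"
    by auto
  ultimately show ?thesis
    by (simp add: card_Un_disjoint card_image)
qed

section \<open>First-step recursions for the counts\<close>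

lemma num_paths_0: "num_paths u n 0 j = of_bool (n = 0 \<and> j = 0)"
proof -
  have "{bs \<in> flip_lists 0 n. path_max u bs = j} = (if n = 0 \<and> j = 0 then {[]} else {})"
    by (auto simp: flip_lists_0)
  then show ?thesis by (simp add: num_paths_def)
qed

lemma num_paths_eq_0:
  assumes "L < j"
  shows "num_paths u n L j = 0"
proof -
  have "{bs \<in> flip_lists L n. path_max u bs = j} = {}"
    using assms by (auto simp: flip_lists_def dest!: path_max_le_length[THEN le_less_trans])
  then show ?thesis by (metis card.empty num_paths_def)
qed

lemma num_paths_up_0: "num_paths True n (Suc L) 0 = 0"
proof -
  have "{bs \<in> flip_lists (Suc L) n. path_max True bs = 0} = {}"
    by (auto simp: flip_lists_def length_Suc_conv)
  then show ?thesis
    by (metis card.empty num_paths_def)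
qed

lemma num_paths_up_no_flip: "num_paths True 0 L j = of_bool (j = L)"
proof (induction L arbitrary: j)
  case (Suc L)
  then show ?case
    by (cases j) (simp_all add: num_paths_up_0, simp add: num_paths_def card_flip_filter_Suc_0)
qed (simp add: num_paths_0)

text \<open>The mark is read after the step, so a true head makes the rest a downward walk with one
  mark fewer; in both cases the rest has to reach \<open>j\<close>.\<close>

lemma num_paths_up_Suc:
  "num_paths True (Suc n) (Suc L) (Suc j) = num_paths True (Suc n) L j + num_paths False n L j"
  by (simp add: num_paths_def card_flip_filter_Suc_Suc)

text \<open>For \<open>j > 0\<close> the truncated subtraction can be undone, so the rest has to
  reach exactly \<open>Suc j\<close>. At \<open>j = 0\<close> the values 0 and 1 are both sent to 0,
  which is why \<open>num_paths_down_Suc_0\<close> has four terms.\<close>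

lemma num_paths_down_Suc:
  assumes "j > 0"
  shows "num_paths False (Suc n) (Suc L) j =
    num_paths False (Suc n) L (Suc j) + num_paths True n L (Suc j)"
proof -
  have "a - 1 = j \<longleftrightarrow> a = Suc j" for a using assms by linarith
  then show ?thesis by (simp add: num_paths_def card_flip_filter_Suc_Suc)
qed

lemma card_flip_filter_le_1:
  "card {bs \<in> flip_lists L n. path_max u bs - 1 = 0} = num_paths u n L 0 + num_paths u n L 1"
proof -
  have "{bs \<in> flip_lists L n. path_max u bs - 1 = 0} =
    {bs \<in> flip_lists L n. path_max u bs = 0} \<union> {bs \<in> flip_lists L n. path_max u bs = 1}"
    by auto
  then show ?thesis
    by (simp add: num_paths_def, subst card_Un_disjoint) auto
qed

lemma num_paths_down_Suc_0:
  "num_paths False (Suc n) (Suc L) 0 =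
     num_paths False (Suc n) L 0 + num_paths False (Suc n) L 1 +
     num_paths True n L 0 + num_paths True n L 1"
  using card_flip_filter_le_1[of L "Suc n" False] card_flip_filter_le_1[of L n True]
  unfolding num_paths_def[of False "Suc n" "Suc L"] card_flip_filter_Suc_Suc
  by simp

lemma num_paths_down_no_flip: "num_paths False 0 L j = of_bool (j = 0)"
proof (induction L arbitrary: j)
  case (Suc L)
  show ?case
  proof (cases "j = 0")
    case True
    with Suc card_flip_filter_le_1[of L 0 False] show ?thesis
      by (simp add: num_paths_def card_flip_filter_Suc_0)
  next
    case False
    then have "a - 1 = j \<longleftrightarrow> a = Suc j" for a by linarith
    with Suc[of "Suc j"] False show ?thesis
      by (simp add: num_paths_def card_flip_filter_Suc_0)
  qed
qed (simp add: num_paths_0)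

text \<open>The three families are closed under the first-step recursion, which becomes Pascal's rule.
  The same holds for the three families of \<open>num_paths_even_chain\<close>.\<close>

lemma num_paths_odd_chain:
  shows num_paths_up_odd: "1 \<le> j \<Longrightarrow> j \<le> L \<Longrightarrow> num_paths True (2 * k + 1) L j =
      ((L + j - 1) div 2 choose k) * (L - 1 - (L + j - 1) div 2 choose k)"
    and num_paths_down_even: "1 \<le> j \<Longrightarrow> j \<le> L \<Longrightarrow> num_paths False (2 * k + 2) L j =
      ((L + j - 1) div 2 choose k) * (L - 1 - (L + j - 1) div 2 choose Suc k)"
    and num_paths_down_even_0: "num_paths False (2 * k + 2) L 0 =
      ((L + 1) div 2 choose Suc k) * (L div 2 choose Suc k)"
proof (induction L arbitrary: j k)
  case 0
  { case 1 then show ?case by simp }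
  { case 2 then show ?case by simp }
  { case 3 then show ?case by (simp add: num_paths_0) }
next
  case (Suc L)
  \<comment> \<open>\<open>Suc.IH(3)\<close> reaches \<open>2 * k\<close> only for
    \<open>k > 0\<close>; a downward walk without reversals has maximum 0 and obeys the same
    formula.\<close>
  have down_0: "num_paths False (2 * k) L 0 = ((L + 1) div 2 choose k) * (L div 2 choose k)" for k
    using Suc.IH(3)[of "k - 1"] by (cases k) (simp_all add: num_paths_down_no_flip)
  { case 1
    obtain i where j: "j = Suc i" using 1 by (cases j) auto
    have rec: "num_paths True (2 * k + 1) (Suc L) j =
      num_paths True (2 * k + 1) L i + num_paths False (2 * k) L i"
      by (simp add: j num_paths_up_Suc)
    show ?case
    proof (cases "i = 0")
      case True
      have "num_paths True (2 * k + 1) L 0 = 0"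
        by (cases L) (simp_all add: num_paths_0 num_paths_up_0)
      moreover have "L - Suc L div 2 = L div 2" by linarith
      ultimately show ?thesis unfolding rec using True j by (simp add: down_0)
    next
      case False
      define a where "a = (L + i - 1) div 2"
      have a: "(Suc L + j - 1) div 2 = Suc a" "Suc L - 1 - Suc a = L - 1 - a"
        using False 1 by (auto simp: j a_def)
      show ?thesis
      proof (cases k)
        case 0
        have "num_paths True 1 L i = 1" using Suc.IH(1)[of i 0] False 1 j by simp
        then show ?thesis unfolding rec using False 0 by (simp add: num_paths_down_no_flip)
      next
        case (Suc l)
        have "num_paths True (2 * k + 1) L i = (a choose k) * (L - 1 - a choose k)"
          using Suc.IH(1)[of i k] False 1 j by (simp add: a_def)
        moreover have "num_paths False (2 * k) L i = (a choose l) * (L - 1 - a choose k)"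
          using Suc.IH(2)[of i l] False 1 j Suc by (simp add: a_def)
        \<comment> \<open>Pascal's rule in the first factor, where \<open>a\<close> becomes
          \<open>Suc a\<close>; the second factor is common to both terms.\<close>
        ultimately show ?thesis unfolding rec a using Suc by (simp add: algebra_simps)
      qed
    qed }
  { case 2
    define a where "a = (Suc L + j - 1) div 2"
    have a: "(L + Suc j - 1) div 2 = a" by (simp add: a_def)
    have rec: "num_paths False (2 * k + 2) (Suc L) j =
      num_paths False (2 * k + 2) L (Suc j) + num_paths True (2 * k + 1) L (Suc j)"
      using num_paths_down_Suc[of j "2 * k + 1" L] 2 by simp
    show ?case
    proof (cases "Suc j \<le> L")
      case True
      \<comment> \<open>Downwards it is the second factor that grows, so Pascal's rule acts
        there.\<close>
      have "Suc L - 1 - a = Suc (L - 1 - a)" using True by (auto simp: a_def)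
      then show ?thesis
        unfolding rec Suc.IH(1)[OF _ True, simplified a] Suc.IH(2)[OF _ True, simplified a]
          a_def[symmetric]
        using Suc.IH(1)[OF _ True, of k] Suc.IH(2)[OF _ True, of k] a
        by (simp add: algebra_simps)
    next
      case False
      then have "Suc L - 1 - a = 0" using 2 by (auto simp: a_def)
      then show ?thesis unfolding rec a_def[symmetric] using False by (simp add: num_paths_eq_0)
    qed }
  { case (3 k)
    have rec: "num_paths False (2 * k + 2) (Suc L) 0 =
      num_paths False (2 * k + 2) L 0 + num_paths False (2 * k + 2) L 1 +
      num_paths True (2 * k + 1) L 0 + num_paths True (2 * k + 1) L 1"
      using num_paths_down_Suc_0[of "2 * k + 1" L] by simp
    show ?case
    proof (cases "L = 0")
      case True
      then show ?thesis unfolding rec by (simp add: num_paths_0 num_paths_eq_0)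
    next
      case False
      define a b where "a = L div 2" and "b = L - 1 - a"
      have ab: "(L + 1) div 2 = Suc b" "(Suc L + 1) div 2 = Suc a" "Suc L div 2 = Suc b"
        using False by (auto simp: a_def b_def)
      have "num_paths False (2 * k + 2) L 1 = (a choose k) * (b choose Suc k)"
        "num_paths True (2 * k + 1) L 1 = (a choose k) * (b choose k)"
        using Suc.IH(1,2)[of 1 k] False by (simp_all add: a_def b_def)
      moreover have "num_paths True (2 * k + 1) L 0 = 0"
        using False num_paths_up_0 by (cases L) auto
      moreover have "num_paths False (2 * k + 2) L 0 = (Suc b choose Suc k) * (a choose Suc k)"
        using Suc.IH(3)[of k] ab by (simp add: a_def)
      \<comment> \<open>The two counts at height 1 merge by Pascal's rule in \<open>b\<close>;
        adding the one at height 0 raises \<open>a\<close>.\<close>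
      ultimately show ?thesis unfolding rec ab by (simp add: algebra_simps)
    qed }
qed


text \<open>Upper index of the first binomial in the second system; as \<open>j\<close> runs, it
  alternates between the two sides of L/2. Along either move of the recursion, from
  \<open>(L, i)\<close> to \<open>(Suc L, Suc i)\<close> or from \<open>(L, Suc j)\<close> to
  \<open>(Suc L, j)\<close>, it is kept or raised by one according to parity, so exactly one of the
  two factors changes.\<close>

definition zigzag :: "nat \<Rightarrow> nat \<Rightarrow> nat" where
  "zigzag L j = (if even (L + j) then (L + j) div 2 else (L + 1 - j) div 2)"

text \<open>The guards correct truncated subtraction: at \<open>zigzag L j = L\<close>, that is
  \<open>j = L\<close>, the second factor would be \<open>0 choose k\<close>, which is 1 for
  \<open>k = 0\<close>. The branch \<open>k = 0\<close> for odd \<open>L + j\<close> is 0 because a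
  downward walk with one reversal attains a positive maximum at its end, at a height of the parity
  of \<open>L\<close>.\<close>

lemma num_paths_even_chain:
  shows num_paths_up_even: "1 \<le> j \<Longrightarrow> j \<le> L \<Longrightarrow> num_paths True (2 * k + 2) L j =
      (if zigzag L j < L then (zigzag L j choose Suc k) * (L - 1 - zigzag L j choose k) else 0)"
    and num_paths_down_odd: "1 \<le> j \<Longrightarrow> j \<le> L \<Longrightarrow> num_paths False (2 * k + 1) L j =
      (if even (L + j)
       then if zigzag L j < L then (zigzag L j choose k) * (L - 1 - zigzag L j choose k) else 0
       else if k = 0 then 0 else (zigzag L j choose Suc k) * (L - 1 - zigzag L j choose (k - 1)))"
    and num_paths_down_odd_0: "L > 0 \<Longrightarrow> num_paths False (2 * k + 1) L 0 =
      (L div 2 + 1 choose Suc k) * ((L - 1) div 2 choose k)"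
proof (induction L arbitrary: j k)
  case 0
  { case 1 then show ?case by simp }
  { case 2 then show ?case by simp }
  { case 3 then show ?case by simp }
next
  case (Suc L)
  { case 1
    obtain i where j: "j = Suc i" using 1 by (cases j) auto
    have rec: "num_paths True (2 * k + 2) (Suc L) j =
      num_paths True (2 * k + 2) L i + num_paths False (2 * k + 1) L i"
      by (simp add: j num_paths_up_Suc)
    show ?case
    proof (cases "i = 0")
      case True
      have up: "num_paths True (2 * k + 2) L 0 = 0"
        by (cases L) (simp_all add: num_paths_0 num_paths_up_0)
      show ?thesis
      proof (cases "L = 0")
        case True
        with up show ?thesis unfolding rec using \<open>i = 0\<close> j by (simp add: num_paths_0 zigzag_def)
      next
        case False
        have z: "zigzag (Suc L) 1 = L div 2 + 1" by (auto simp: zigzag_def elim: oddE)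
        have "L div 2 + 1 < Suc L" "L - (L div 2 + 1) = (L - 1) div 2"
          using False by linarith+
        with False True j up show ?thesis
          unfolding rec using Suc.IH(3)[of k] z by simp
      qed
    next
      case False
      define x where "x = zigzag L i"
      have IH: "num_paths True (2 * k + 2) L i =
          (if x < L then (x choose Suc k) * (L - 1 - x choose k) else 0)"
        "num_paths False (2 * k + 1) L i = (if even (L + i)
          then if x < L then (x choose k) * (L - 1 - x choose k) else 0
          else if k = 0 then 0 else (x choose Suc k) * (L - 1 - x choose (k - 1)))"
        using Suc.IH(1,2)[of i k] False 1 j by (simp_all add: x_def)
      show ?thesis
      proof (cases "even (L + i)")
        case True
        then have "zigzag (Suc L) j = Suc x" by (auto simp: zigzag_def x_def j)
        with True show ?thesis unfolding rec IH by (simp add: algebra_simps)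
      next
        case odd: False
        then have z: "zigzag (Suc L) j = x" by (auto simp: zigzag_def x_def j)
        have "x < L" using odd False 1 j by (auto simp: zigzag_def x_def elim!: oddE)
        then have "L - x = Suc (L - 1 - x)" by simp
        with odd z \<open>x < L\<close> show ?thesis unfolding rec IH by (cases k) (simp_all add: algebra_simps)
      qed
    qed }
  { case 2
    define x where "x = zigzag L (Suc j)"
    have rec: "num_paths False (2 * k + 1) (Suc L) j =
      num_paths False (2 * k + 1) L (Suc j) + num_paths True (2 * k) L (Suc j)"
      using num_paths_down_Suc[of j "2 * k" L] 2 by simp
    show ?case
    proof (cases "Suc j \<le> L")
      case True
      \<comment> \<open>\<open>Suc.IH(1)\<close> reaches \<open>2 * k\<close> through
        \<open>k - 1\<close>; for \<open>k = 0\<close> the upward walk has no reversal and maximum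
        \<open>L\<close>.\<close>
      have IH: "num_paths True (2 * k) L (Suc j) = (if k = 0 then of_bool (Suc j = L) else
          if x < L then (x choose k) * (L - 1 - x choose (k - 1)) else 0)"
        "num_paths False (2 * k + 1) L (Suc j) = (if even (L + Suc j)
          then if x < L then (x choose k) * (L - 1 - x choose k) else 0
          else if k = 0 then 0 else (x choose Suc k) * (L - 1 - x choose (k - 1)))"
        using Suc.IH(1)[of "Suc j" "k - 1"] Suc.IH(2)[of "Suc j" k] True
        by (cases k; simp add: x_def num_paths_up_no_flip)+
      show ?thesis
      proof (cases "even (L + Suc j)")
        case even: True
        then have z: "zigzag (Suc L) j = x" by (auto simp: zigzag_def x_def)
        obtain w where w: "L + Suc j = 2 * w" using even by (elim evenE)
        then have "x = w" by (simp add: zigzag_def x_def)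
        then have xL: "x \<le> L" "x = L \<longleftrightarrow> Suc j = L"
          using w True by linarith+
        show ?thesis
        \<comment> \<open>At \<open>x = L\<close> only the upward walk without reversals
          contributes; below it, Pascal's rule applies to the second factor.\<close>
        proof (cases "x = L")
          case True
          with z xL even show ?thesis unfolding rec IH by (auto simp: binomial_eq_0)
        next
          case False
          then have "L - x = Suc (L - 1 - x)" using xL by simp
          with z xL even False show ?thesis unfolding rec IH
            by (cases k) (auto simp: algebra_simps)
        qed
      next
        case odd: False
        then have z: "zigzag (Suc L) j = Suc x"
          using True by (auto simp: zigzag_def x_def elim!: oddE)
        have "x < L" using odd True by (auto simp: zigzag_def x_def elim!: oddE)
        with z odd show ?thesis unfolding rec IH by (cases k) (auto simp: algebra_simps)
      qed
    next
      case False
      then have "j = L \<or> j = Suc L" using 2 by auto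
      then have "zigzag (Suc L) j = (if j = L then 1 else Suc L)"
        by (auto simp: zigzag_def)
      then show ?thesis unfolding rec using False \<open>j = L \<or> j = Suc L\<close>
        by (auto simp: num_paths_eq_0)
    qed }
  { case (3 k)
    have rec: "num_paths False (2 * k + 1) (Suc L) 0 =
      num_paths False (2 * k + 1) L 0 + num_paths False (2 * k + 1) L 1 +
      num_paths True (2 * k) L 0 + num_paths True (2 * k) L 1"
      using num_paths_down_Suc_0[of "2 * k" L] by simp
    \<comment> \<open>Lengths 0 and 1 are separate because the parity split below writes
      \<open>L\<close> as \<open>2 * s + 2\<close> or \<open>2 * s + 3\<close>.\<close>
    consider "L = 0" | "L = 1" | "L > 1" by linarith
    then show ?case
    proof cases
      case 1
      then show ?thesis unfolding rec by (auto simp: num_paths_0 num_paths_eq_0)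
    next
      case 2
      have "num_paths True (2 * k) (Suc 0) 0 = 0" by (rule num_paths_up_0)
      with 2 show ?thesis unfolding rec
        using Suc.IH(1)[of 1 "k - 1"] Suc.IH(2)[of 1 k] Suc.IH(3)[of k]
        by (cases k) (auto simp: zigzag_def num_paths_up_no_flip)
    next
      case 3
      define x where "x = zigzag L 1"
      have up: "num_paths True (2 * k) L 0 = 0"
        using num_paths_up_0[of "2 * k" "L - 1"] 3 by simp
      have IH: "num_paths True (2 * k) L 1 = (if k = 0 then 0 else
          if x < L then (x choose k) * (L - 1 - x choose (k - 1)) else 0)"
        "num_paths False (2 * k + 1) L 1 = (if even (L + 1)
          then if x < L then (x choose k) * (L - 1 - x choose k) else 0
          else if k = 0 then 0 else (x choose Suc k) * (L - 1 - x choose (k - 1)))"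
        "num_paths False (2 * k + 1) L 0 = (L div 2 + 1 choose Suc k) * ((L - 1) div 2 choose k)"
        using Suc.IH(1)[of 1 "k - 1"] Suc.IH(2)[of 1 k] Suc.IH(3)[of k] 3
        by (cases k; simp add: x_def num_paths_up_no_flip)+
      show ?thesis
      proof (cases "even L")
        case True
        then obtain r where r: "L = 2 * r" by (elim evenE)
        then obtain s where s: "r = Suc s" using 3 by (cases r) auto
        have x: "x = Suc s" "L = 2 * s + 2" by (auto simp: x_def zigzag_def r s)
        then have "(L - 1) div 2 = s" "L div 2 = Suc s" "L - 1 - x = s" by auto
        with x True show ?thesis unfolding rec up IH
          by (cases k) (simp_all add: algebra_simps)
      next
        case False
        then obtain r where r: "L = 2 * r + 1" by (elim oddE)
        then obtain s where s: "r = Suc s" using 3 by (cases r) auto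
        have x: "x = Suc (Suc s)" "L = 2 * s + 3" by (auto simp: x_def zigzag_def r s)
        then have "(L - 1) div 2 = Suc s" "L div 2 = Suc s" "L - 1 - x = s"
          "Suc L div 2 = Suc (Suc s)" by auto
        with x False show ?thesis unfolding rec up IH
          by (cases k) (simp_all add: algebra_simps)
      qed
    qed }
qed

section \<open>Riemann sums and the limiting moments\<close>

text \<open>The binomial counts depend on the mesh as well as on the sampling point, so the mesh
  \<open>1 / r\<close> enters as a second argument. Uniform continuity on the compact square
  controls both errors at once.\<close>

lemma riemann_sum_tendsto:
  fixes \<Phi> :: "real \<Rightarrow> real \<Rightarrow> real"
  assumes cont: "continuous_on ({0..1} \<times> {0..1}) (\<lambda>(x, y). \<Phi> x y)"
  shows "(\<lambda>r. (\<Sum>i<r. \<Phi> (real i / real r) (1 / real r)) / real r)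
           \<longlonglongrightarrow> integral {0..1} (\<lambda>u. \<Phi> u 0)"
proof (rule LIMSEQ_I)
  fix e :: real assume e: "e > 0"
  have "uniformly_continuous_on ({0..1} \<times> {0..1}) (\<lambda>(x, y). \<Phi> x y)"
    by (intro compact_uniformly_continuous cont compact_Times compact_Icc)
  then obtain d where d: "d > 0" and
    unif: "\<And>p q. p \<in> {0..1} \<times> {0..1} \<Longrightarrow> q \<in> {0..1} \<times> {0..1} \<Longrightarrow> dist q p < d \<Longrightarrow>
      dist ((\<lambda>(x, y). \<Phi> x y) q) ((\<lambda>(x, y). \<Phi> x y) p) < e / 2"
    unfolding uniformly_continuous_on_def using e by (metis half_gt_zero)
  have int: "(\<lambda>u. \<Phi> u 0) integrable_on {a..b}" if "0 \<le> a" "b \<le> 1" for a b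
  proof (rule integrable_continuous_real)
    have "continuous_on {a..b} ((\<lambda>(x, y). \<Phi> x y) \<circ> (\<lambda>u. (u, 0)))"
      by (intro continuous_on_compose continuous_intros continuous_on_subset[OF cont])
        (use that in auto)
    then show "continuous_on {a..b} (\<lambda>u. \<Phi> u 0)" by (simp add: o_def)
  qed
  \<comment> \<open>The sampling point and the mesh argument each move by at most
    \<open>1 / r\<close>, hence the 2.\<close>
  obtain R :: nat where R: "2 / d < real R" using reals_Archimedean2 by blast
  show "\<exists>no. \<forall>r\<ge>no. norm ((\<Sum>i<r. \<Phi> (real i / real r) (1 / real r)) / real r
      - integral {0..1} (\<lambda>u. \<Phi> u 0)) < e"
  proof (intro exI allI impI)
    fix r assume r: "r \<ge> max R 1"
    then have r0: "real r > 0" by simp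
    have "2 / d < real r" using R r by linarith
    then have rd: "2 / real r < d" using d r0 by (simp add: field_simps)
    have split: "integral {0..real n / real r} (\<lambda>u. \<Phi> u 0) =
      (\<Sum>i<n. integral {real i / real r..real (Suc i) / real r} (\<lambda>u. \<Phi> u 0))" if "n \<le> r" for n
      using that
    proof (induction n)
      case (Suc n)
      have "integral {0..real n / real r} (\<lambda>u. \<Phi> u 0) +
        integral {real n / real r..real (Suc n) / real r} (\<lambda>u. \<Phi> u 0) =
        integral {0..real (Suc n) / real r} (\<lambda>u. \<Phi> u 0)"
        by (rule Henstock_Kurzweil_Integration.integral_combine)
          (use Suc.prems r0 in \<open>auto intro!: int simp: divide_simps\<close>)
      with Suc show ?case by simp
    qed simp
    have cell: "\<bar>\<Phi> (real i / real r) (1 / real r) / real r -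
      integral {real i / real r..real (Suc i) / real r} (\<lambda>u. \<Phi> u 0)\<bar> \<le> e / 2 / real r"
      if "i < r" for i
    proof -
      let ?I = "{real i / real r..real (Suc i) / real r}"
      have I: "0 \<le> real i / real r" "real (Suc i) / real r \<le> 1"
        "real (Suc i) / real r - real i / real r = 1 / real r"
        "real i / real r \<le> real (Suc i) / real r"
        using that r0 by (auto simp: field_simps)
      have "((\<lambda>u. \<Phi> (real i / real r) (1 / real r)) has_integral
          \<Phi> (real i / real r) (1 / real r) / real r) ?I"
        using has_integral_const_real[of "\<Phi> (real i / real r) (1 / real r)" "real i / real r"
            "real (Suc i) / real r"] I by simp
      then have hi: "((\<lambda>u. \<Phi> (real i / real r) (1 / real r) - \<Phi> u 0) has_integral
          (\<Phi> (real i / real r) (1 / real r) / real r - integral ?I (\<lambda>u. \<Phi> u 0))) ?I"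
        by (intro has_integral_diff integrable_integral int I)
      have "norm (\<Phi> (real i / real r) (1 / real r) / real r - integral ?I (\<lambda>u. \<Phi> u 0))
          \<le> e / 2 * Henstock_Kurzweil_Integration.content ?I"
      proof (rule has_integral_bound_real[OF _ finite.emptyI hi])
        show "0 \<le> e / 2" using e by simp
        fix u assume u: "u \<in> ?I - {}"
        then have u': "0 \<le> u" "u \<le> 1" using I(1,2) unfolding Diff_empty atLeastAtMost_iff by linarith+
        have "dist (real i / real r, 1 / real r) (u, 0) \<le>
            \<bar>real i / real r - u\<bar> + \<bar>1 / real r - 0\<bar>"
          unfolding dist_prod_def dist_real_def fst_conv snd_conv real_sqrt_abs power2_abs
          by (rule sqrt_sum_squares_le_sum_abs)
        also have "\<dots> \<le> 1 / real r + 1 / real r"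
          using u I by auto
        also have "\<dots> < d" using rd by simp
        finally have "dist (real i / real r, 1 / real r) (u, 0) < d" .
        then have "dist (\<Phi> (real i / real r) (1 / real r)) (\<Phi> u 0) < e / 2"
          using unif[of "(u, 0)" "(real i / real r, 1 / real r)"] u' I r that by auto
        then show "norm (\<Phi> (real i / real r) (1 / real r) - \<Phi> u 0) \<le> e / 2"
          by (simp add: dist_norm)
      qed
      then show ?thesis using I by simp
    qed
    have "integral {0..1} (\<lambda>u. \<Phi> u 0) =
      (\<Sum>i<r. integral {real i / real r..real (Suc i) / real r} (\<lambda>u. \<Phi> u 0))"
      using split[of r] r0 by simp
    then have "norm ((\<Sum>i<r. \<Phi> (real i / real r) (1 / real r)) / real r
      - integral {0..1} (\<lambda>u. \<Phi> u 0)) =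
      \<bar>\<Sum>i<r. \<Phi> (real i / real r) (1 / real r) / real r -
        integral {real i / real r..real (Suc i) / real r} (\<lambda>u. \<Phi> u 0)\<bar>"
      by (simp add: sum_subtractf sum_divide_distrib)
    also have "\<dots> \<le> (\<Sum>i<r. e / 2 / real r)"
      by (rule order_trans[OF sum_abs sum_mono]) (use cell in auto)
    also have "\<dots> < e" using r0 e by simp
    finally show "norm ((\<Sum>i<r. \<Phi> (real i / real r) (1 / real r)) / real r
      - integral {0..1} (\<lambda>u. \<Phi> u 0)) < e" .
  qed
qed

lemma Gamma_plus1_pos: "a > 0 \<Longrightarrow> Gamma (a + 1) = a * Gamma (a :: real)"
  by (rule Gamma_plus1) (auto dest: nonpos_Ints_nonpos)

text \<open>Half the Beta integral with parameters (m+1)/2 and k+1. Expanding one factor 1 - u^2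
  reduces \<open>Suc k\<close> to \<open>k\<close> at \<open>m\<close> and \<open>m + 2\<close>,
  hence \<open>arbitrary: m\<close>; the shift by 2 raises the Gamma argument by exactly
  one.\<close>

lemma has_integral_power_mult_one_minus_square:
  "((\<lambda>u::real. u ^ m * (1 - u\<^sup>2) ^ k) has_integral
     fact k / 2 * (Gamma ((real m + 1) / 2) / Gamma (real k + 1 + (real m + 1) / 2))) {0..1}"
proof (induction k arbitrary: m)
  case 0
  have "((\<lambda>u::real. u ^ m) has_integral (1 ^ Suc m / real (Suc m) - 0 ^ Suc m / real (Suc m))) {0..1}"
  proof (rule fundamental_theorem_of_calculus)
    fix u :: real
    show "((\<lambda>u. u ^ Suc m / real (Suc m)) has_vector_derivative u ^ m) (at u within {0..1})"
      using DERIV_cdivide[OF DERIV_pow[of "Suc m" u "{0..1}"], of "real (Suc m)"]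
      by (simp add: has_real_derivative_iff_has_vector_derivative del: power_Suc of_nat_Suc)
  qed simp
  moreover define a where "a = (real m + 1) / 2"
  have a: "a > 0" by (simp add: a_def)
  then have "Gamma (a + 1) = a * Gamma a" "Gamma a \<noteq> 0"
    using Gamma_plus1_pos[of a] Gamma_real_pos[of a] by (blast, metis less_irrefl)
  then have "Gamma a / Gamma (1 + a) = 1 / a"
    by (simp add: add.commute)
  ultimately show ?case unfolding a_def[symmetric] by (simp add: a_def add.commute)
next
  case (Suc k)
  define a where "a = (real m + 1) / 2"
  have a: "a > 0" by (simp add: a_def)
  have a2: "(real (m + 2) + 1) / 2 = a + 1" by (simp add: a_def field_simps)
  have G: "Gamma (a + 1) = a * Gamma a"
    by (rule Gamma_plus1_pos) (use a in simp)
  have "Gamma ((real k + 1 + a) + 1) = (real k + 1 + a) * Gamma (real k + 1 + a)"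
    by (rule Gamma_plus1_pos) (use a in simp)
  then have G': "Gamma (real k + 1 + (a + 1)) = (real k + 1 + a) * Gamma (real k + 1 + a)"
    by (simp add: add_ac)
  have pos: "Gamma (real k + 1 + a) > 0" by (rule Gamma_real_pos) (use a in simp)
  have "((\<lambda>u::real. u ^ m * (1 - u\<^sup>2) ^ k - u ^ (m + 2) * (1 - u\<^sup>2) ^ k) has_integral
    fact k / 2 * (Gamma a / Gamma (real k + 1 + a)) -
    fact k / 2 * (Gamma (a + 1) / Gamma (real k + 1 + (a + 1)))) {0..1}"
    using has_integral_diff[OF Suc.IH[of m] Suc.IH[of "m + 2"]] unfolding a2 unfolding a_def .
  moreover have "(\<lambda>u::real. u ^ m * (1 - u\<^sup>2) ^ k - u ^ (m + 2) * (1 - u\<^sup>2) ^ k) =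
    (\<lambda>u. u ^ m * (1 - u\<^sup>2) ^ Suc k)"
    by (simp add: fun_eq_iff power_add power2_eq_square algebra_simps)
  moreover have "fact k / 2 * (Gamma a / Gamma (real k + 1 + a)) -
    fact k / 2 * (Gamma (a + 1) / Gamma (real k + 1 + (a + 1))) =
    fact (Suc k) / 2 * (Gamma a / Gamma (real (Suc k) + 1 + a))"
  proof -
    have e: "real (Suc k) + 1 + a = real k + 1 + (a + 1)" by simp
    show ?thesis unfolding e G G' using pos a by (simp add: divide_simps) (simp add: algebra_simps)
  qed
  ultimately show ?case unfolding a_def by metis
qed

section \<open>Lattice moments as Riemann sums\<close>

lemma sum_path_max:
  fixes g :: "nat \<Rightarrow> real"
  shows "(\<Sum>bs\<in>flip_lists L n. g (path_max u bs)) = (\<Sum>j\<le>L. real (num_paths u n L j) * g j)"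
proof -
  have "path_max u ` flip_lists L n \<subseteq> {..L}"
    using path_max_le_length by (auto simp: flip_lists_def)
  from sum.group[OF finite_flip_lists finite_atMost this, of "\<lambda>bs. g (path_max u bs)"]
  have "(\<Sum>bs\<in>flip_lists L n. g (path_max u bs)) =
      (\<Sum>j\<le>L. \<Sum>bs | bs \<in> flip_lists L n \<and> path_max u bs = j. g (path_max u bs))" by simp
  also have "\<dots> = (\<Sum>j\<le>L. real (num_paths u n L j) * g j)"
    by (rule sum.cong) (auto simp: num_paths_def)
  finally show ?thesis .
qed

text \<open>Two pairings of neighbours: for an odd number of reversals \<open>2 * i + 1\<close> and
  \<open>2 * i + 2\<close> have equal counts; for an even number \<open>2 * i\<close> and
  \<open>2 * i + 1\<close> are the two branches of \<open>zigzag\<close>.\<close>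

lemma sum_atMost_double:
  fixes f :: "nat \<Rightarrow> 'a :: ab_group_add"
  shows "(\<Sum>j\<le>2 * r. f j) = f 0 + (\<Sum>i<r. f (2 * i + 1) + f (2 * i + 2))"
    and "(\<Sum>j\<le>2 * r. f j) = (\<Sum>i<r. f (2 * i) + f (2 * i + 1)) + f (2 * r)"
  by (induction r) (simp_all add: algebra_simps)

lemma sum_path_max_odd:
  fixes g :: "nat \<Rightarrow> real"
  assumes "r > 0"
  shows "(\<Sum>bs\<in>flip_lists (2 * r) (2 * k + 1). g (path_max True bs)) =
    (\<Sum>i<r. real (r + i choose k) * real (r - 1 - i choose k) * (g (2 * i + 1) + g (2 * i + 2)))"
proof -
  have "num_paths True (2 * k + 1) (2 * r) 0 = 0"
    using num_paths_up_0[of _ "2 * r - 1"] assms by simp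
  moreover have "num_paths True (2 * k + 1) (2 * r) (2 * i + 1) =
      (r + i choose k) * (r - 1 - i choose k)"
    "num_paths True (2 * k + 1) (2 * r) (2 * i + 2) = (r + i choose k) * (r - 1 - i choose k)"
    if "i < r" for i
  proof -
    have e: "(2 * r + (2 * i + 1) - 1) div 2 = r + i" "(2 * r + (2 * i + 2) - 1) div 2 = r + i"
      "2 * r - 1 - (r + i) = r - 1 - i"
      using that by auto
    show "num_paths True (2 * k + 1) (2 * r) (2 * i + 1) = (r + i choose k) * (r - 1 - i choose k)"
      using num_paths_up_odd[of "2 * i + 1" "2 * r" k] that unfolding e by simp
    show "num_paths True (2 * k + 1) (2 * r) (2 * i + 2) = (r + i choose k) * (r - 1 - i choose k)"
      using num_paths_up_odd[of "2 * i + 2" "2 * r" k] that unfolding e by simp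
  qed
  ultimately show ?thesis
    unfolding sum_path_max sum_atMost_double(1) by (simp add: algebra_simps)
qed

text \<open>The assumption \<open>g 0 = 0\<close> removes the term \<open>j = 0\<close>, where the closed form does not vanish although
  no path has maximum 0.\<close>

lemma sum_path_max_even:
  fixes g :: "nat \<Rightarrow> real"
  assumes "r > 0" and "g 0 = 0"
  shows "(\<Sum>bs\<in>flip_lists (2 * r) (2 * k + 2). g (path_max True bs)) =
    (\<Sum>i<r. real (r + i choose Suc k) * real (r - 1 - i choose k) * g (2 * i) +
      real (r - i choose Suc k) * real (r + i - 1 choose k) * g (2 * i + 1))"
proof -
  \<comment> \<open>The unpaired last term vanishes: a walk that climbs to its full length can be
    reversed only after its last step.\<close>
  have "zigzag (2 * r) (2 * r) = 2 * r" by (simp add: zigzag_def)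
  then have "num_paths True (2 * k + 2) (2 * r) (2 * r) = 0"
    using assms by (subst num_paths_up_even) auto
  moreover have "real (num_paths True (2 * k + 2) (2 * r) (2 * i)) * g (2 * i) =
      real (r + i choose Suc k) * real (r - 1 - i choose k) * g (2 * i)" if "i < r" for i
  proof (cases "i = 0")
    case False
    have "zigzag (2 * r) (2 * i) = r + i" "2 * r - 1 - (r + i) = r - 1 - i"
      using that by (auto simp: zigzag_def)
    with False that show ?thesis by (subst num_paths_up_even) auto
  qed (use assms in auto)
  moreover have "num_paths True (2 * k + 2) (2 * r) (2 * i + 1) =
      (r - i choose Suc k) * (r + i - 1 choose k)" if "i < r" for i
  proof -
    have "zigzag (2 * r) (2 * i + 1) = r - i" "2 * r - 1 - (r - i) = r + i - 1"
      using that by (auto simp: zigzag_def)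
    with that show ?thesis by (subst num_paths_up_even) auto
  qed
  ultimately show ?thesis
    unfolding sum_path_max sum_atMost_double(2) by (auto intro!: sum.cong)
qed

text \<open>The falling product of a binomial coefficient, with n/r for \<open>x\<close> and 1/r for
  \<delta>. As a polynomial in both it is continuous up to \<open>\<delta> = 0\<close>, where it
  becomes \<open>x ^ k\<close>.\<close>

definition scaled_falling :: "nat \<Rightarrow> real \<Rightarrow> real \<Rightarrow> real" where
  "scaled_falling k x \<delta> = (\<Prod>l<k. x - real l * \<delta>)"

lemma binomial_eq_scaled_falling:
  fixes r :: real
  assumes "r > 0"
  shows "real (n choose k) = r ^ k / fact k * scaled_falling k (real n / r) (1 / r)"
proof -
  have "real (n choose k) = (\<Prod>l<k. real n - real l) / fact k"
    unfolding binomial_gbinomial gbinomial_prod_rev by (simp add: atLeast0LessThan)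
  also have "(\<Prod>l<k. real n - real l) = (\<Prod>l<k. r * (real n / r - real l * (1 / r)))"
    using assms by (intro prod.cong) (auto simp: field_simps)
  also have "\<dots> = r ^ k * scaled_falling k (real n / r) (1 / r)"
    by (simp add: prod.distrib scaled_falling_def)
  finally show ?thesis by simp
qed

lemma scaled_falling_0 [simp]: "scaled_falling k x 0 = x ^ k"
  by (simp add: scaled_falling_def)

lemma continuous_on_scaled_falling [continuous_intros]:
  assumes "continuous_on S f" "continuous_on S h"
  shows "continuous_on S (\<lambda>x. scaled_falling k (f x) (h x))"
  unfolding scaled_falling_def by (intro continuous_intros assms)

text \<open>The asserted value for \<open>c * t = 1\<close>: the m-th moment of the density
  proportional to (1 - u^2)^k on [0,1].\<close>

definition max_moment :: "nat \<Rightarrow> nat \<Rightarrow> real" where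
  "max_moment m k = fact (2 * k + 1) / (2 ^ (2 * k + 1) * fact k) *
     (Gamma ((real m + 1) / 2) / Gamma (real k + 1 + (real m + 1) / 2))"

text \<open>The weight is the probability of one pattern divided by that of the conditioning event,
  not the reciprocal of the number of patterns; the missing mass belongs to cells with several
  jumps.\<close>

definition path_moment :: "nat \<Rightarrow> nat \<Rightarrow> nat \<Rightarrow> real" where
  "path_moment m n L =
     fact n / real L ^ n * (\<Sum>bs\<in>flip_lists L n. (real (path_max True bs) / real L) ^ m)"

lemma path_moment_odd_tendsto:
  "(\<lambda>r. path_moment m (2 * k + 1) (2 * r)) \<longlonglongrightarrow> max_moment m k"
proof -
  \<comment> \<open>Here u = i/r and \<delta> = 1/r. The powers come from the heights (2i+1)/(2r)
    and (2i+2)/(2r), and the summand -\<delta> from \<open>r - 1 - i\<close>.\<close>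
  define \<Phi> :: "real \<Rightarrow> real \<Rightarrow> real" where
    "\<Phi> = (\<lambda>u \<delta>. scaled_falling k (1 + u) \<delta> * scaled_falling k (1 - \<delta> - u) \<delta> *
       ((u + \<delta> / 2) ^ m + (u + \<delta>) ^ m))"
  \<comment> \<open>What remains of (2k+1)!/(2r)^(2k+1) times r^(2k)/(k!)^2 after one factor 1/r has
    gone into the Riemann sum.\<close>
  let ?C = "fact (2 * k + 1) / (2 ^ (2 * k + 1) * (fact k)\<^sup>2) :: real"
  have "(\<lambda>r. (\<Sum>i<r. \<Phi> (real i / real r) (1 / real r)) / real r)
      \<longlonglongrightarrow> integral {0..1} (\<lambda>u. \<Phi> u 0)"
    by (rule riemann_sum_tendsto) (auto simp: \<Phi>_def case_prod_unfold intro!: continuous_intros)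
  moreover have "integral {0..1} (\<lambda>u. \<Phi> u 0) =
      fact k * (Gamma ((real m + 1) / 2) / Gamma (real k + 1 + (real m + 1) / 2))"
  proof -
    have "\<Phi> u 0 = 2 * (u ^ m * (1 - u\<^sup>2) ^ k)" for u
      by (simp add: \<Phi>_def power_mult_distrib[symmetric] power2_eq_square algebra_simps)
    then show ?thesis
      using has_integral_power_mult_one_minus_square[THEN integral_unique, of m k] by simp
  qed
  ultimately have "(\<lambda>r. ?C * ((\<Sum>i<r. \<Phi> (real i / real r) (1 / real r)) / real r))
      \<longlonglongrightarrow> ?C * (fact k * (Gamma ((real m + 1) / 2) / Gamma (real k + 1 + (real m + 1) / 2)))"
    by (intro tendsto_mult_left) simp
  also have "?C * (fact k * (Gamma ((real m + 1) / 2) / Gamma (real k + 1 + (real m + 1) / 2))) =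
      max_moment m k"
    by (simp add: max_moment_def power2_eq_square)
  finally show ?thesis
  proof (rule Lim_transform_eventually)
    show "\<forall>\<^sub>F r in sequentially. ?C * ((\<Sum>i<r. \<Phi> (real i / real r) (1 / real r)) / real r) =
        path_moment m (2 * k + 1) (2 * r)"
      using eventually_gt_at_top[of 0]
    proof eventually_elim
      case (elim r)
      then have r: "real r > 0" by simp
      have "real (r + i choose k) * real (r - 1 - i choose k) *
          ((real (2 * i + 1) / real (2 * r)) ^ m + (real (2 * i + 2) / real (2 * r)) ^ m) =
          real r ^ (2 * k) / (fact k)\<^sup>2 * \<Phi> (real i / real r) (1 / real r)" if "i < r" for i
      proof -
        have e: "real (r + i) / real r = 1 + real i / real r"
          "real (r - 1 - i) / real r = 1 - 1 / real r - real i / real r"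
          "real (2 * i + 1) / real (2 * r) = real i / real r + (1 / real r) / 2"
          "real (2 * i + 2) / real (2 * r) = real i / real r + 1 / real r"
          using that r by (auto simp: field_simps of_nat_diff)
        show ?thesis
          unfolding binomial_eq_scaled_falling[OF r] e \<Phi>_def
          by (simp add: power2_eq_square mult_2 power_add)
      qed
      then have "path_moment m (2 * k + 1) (2 * r) =
        fact (2 * k + 1) / real (2 * r) ^ (2 * k + 1) *
          (\<Sum>i<r. real r ^ (2 * k) / (fact k)\<^sup>2 * \<Phi> (real i / real r) (1 / real r))"
        unfolding path_moment_def
          sum_path_max_odd[OF elim, of "\<lambda>j. (real j / real (2 * r)) ^ m"] by simp
      also have "\<dots> = ?C * ((\<Sum>i<r. \<Phi> (real i / real r) (1 / real r)) / real r)"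
        using r unfolding sum_distrib_left[symmetric]
        by (simp add: power_mult_distrib divide_simps)
      finally show ?case ..
    qed
  qed
qed

text \<open>In the limit the two neighbours contribute u^m times (1+u)^(k+1) (1-u)^k and (1-u)^(k+1)
  (1+u)^k. As (1+u) + (1-u) = 2, their sum is the integrand of the odd case, which is why both
  conditional moments coincide. With \<open>m > 0\<close> the height 0 has weight 0, as
  \<open>sum_path_max_even\<close> requires.\<close>

lemma path_moment_even_tendsto:
  assumes "m > 0"
  shows "(\<lambda>r. path_moment m (2 * k + 2) (2 * r)) \<longlonglongrightarrow> max_moment m k"
proof -
  define \<Phi> :: "real \<Rightarrow> real \<Rightarrow> real" where
    "\<Phi> = (\<lambda>u \<delta>. scaled_falling (Suc k) (1 + u) \<delta> * scaled_falling k (1 - \<delta> - u) \<delta> * u ^ m +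
       scaled_falling (Suc k) (1 - u) \<delta> * scaled_falling k (1 + u - \<delta>) \<delta> * (u + \<delta> / 2) ^ m)"
  let ?C = "fact (2 * k + 2) / (2 ^ (2 * k + 2) * (fact (Suc k) * fact k)) :: real"
  have "(\<lambda>r. (\<Sum>i<r. \<Phi> (real i / real r) (1 / real r)) / real r)
      \<longlonglongrightarrow> integral {0..1} (\<lambda>u. \<Phi> u 0)"
    by (rule riemann_sum_tendsto) (auto simp: \<Phi>_def case_prod_unfold intro!: continuous_intros)
  moreover have "integral {0..1} (\<lambda>u. \<Phi> u 0) =
      fact k * (Gamma ((real m + 1) / 2) / Gamma (real k + 1 + (real m + 1) / 2))"
  proof -
    have "\<Phi> u 0 = 2 * (u ^ m * (1 - u\<^sup>2) ^ k)" for u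
    proof -
      have "\<Phi> u 0 = ((1 + u) + (1 - u)) * (u ^ m * ((1 + u) ^ k * (1 - u) ^ k))"
        by (simp add: \<Phi>_def algebra_simps)
      then show ?thesis
        by (simp add: power_mult_distrib[symmetric] power2_eq_square algebra_simps)
    qed
    then show ?thesis
      using has_integral_power_mult_one_minus_square[THEN integral_unique, of m k] by simp
  qed
  ultimately have "(\<lambda>r. ?C * ((\<Sum>i<r. \<Phi> (real i / real r) (1 / real r)) / real r))
      \<longlonglongrightarrow> ?C * (fact k * (Gamma ((real m + 1) / 2) / Gamma (real k + 1 + (real m + 1) / 2)))"
    by (intro tendsto_mult_left) simp
  also have "?C * (fact k * (Gamma ((real m + 1) / 2) / Gamma (real k + 1 + (real m + 1) / 2))) =
      max_moment m k"
  proof -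
    \<comment> \<open>From (2k+2)!/(k+1)! = 2 (2k+1)!/k!.\<close>
    have "?C * fact k = fact (2 * k + 1) / (2 ^ (2 * k + 1) * fact k)"
      by (simp add: divide_simps)
    then show ?thesis unfolding max_moment_def mult.assoc[symmetric] by simp
  qed
  finally show ?thesis
  proof (rule Lim_transform_eventually)
    show "\<forall>\<^sub>F r in sequentially. ?C * ((\<Sum>i<r. \<Phi> (real i / real r) (1 / real r)) / real r) =
        path_moment m (2 * k + 2) (2 * r)"
      using eventually_gt_at_top[of 0]
    proof eventually_elim
      case (elim r)
      then have r: "real r > 0" by simp
      have "real (r + i choose Suc k) * real (r - 1 - i choose k) * (real (2 * i) / real (2 * r)) ^ m +
          real (r - i choose Suc k) * real (r + i - 1 choose k) *
            (real (2 * i + 1) / real (2 * r)) ^ m =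
          real r ^ (2 * k + 1) / (fact (Suc k) * fact k) * \<Phi> (real i / real r) (1 / real r)"
        if "i < r" for i
      proof -
        have e: "real (r + i) / real r = 1 + real i / real r"
          "real (r - 1 - i) / real r = 1 - 1 / real r - real i / real r"
          "real (r - i) / real r = 1 - real i / real r"
          "real (r + i - 1) / real r = 1 + real i / real r - 1 / real r"
          "real (2 * i + 1) / real (2 * r) = real i / real r + (1 / real r) / 2"
          "real (2 * i) / real (2 * r) = real i / real r"
          using that r by (auto simp: field_simps of_nat_diff)
        have "real r ^ (2 * k + 1) / (fact (Suc k) * fact k) =
          real r ^ Suc k / fact (Suc k) * (real r ^ k / fact k)"
          by (simp add: mult_2 power_add)
        then show ?thesis
          unfolding binomial_eq_scaled_falling[OF r] e \<Phi>_def
          by (simp only: algebra_simps)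
      qed
      then have "path_moment m (2 * k + 2) (2 * r) =
        fact (2 * k + 2) / real (2 * r) ^ (2 * k + 2) *
          (\<Sum>i<r. real r ^ (2 * k + 1) / (fact (Suc k) * fact k) * \<Phi> (real i / real r) (1 / real r))"
        unfolding path_moment_def
        using sum_path_max_even[OF elim, of "\<lambda>j. (real j / real (2 * r)) ^ m"] assms by simp
      also have "\<dots> = ?C * ((\<Sum>i<r. \<Phi> (real i / real r) (1 / real r)) / real r)"
        using r unfolding sum_distrib_left[symmetric]
        by (simp add: power_mult_distrib divide_simps)
      finally show ?case ..
    qed
  qed
qed

lemma max_moment_1: "max_moment 1 k = real ((2 * k + 1) choose k) / 2 ^ (2 * k + 1)"
proof -
  have "real ((2 * k + 1) choose k) = fact (2 * k + 1) / (fact k * fact (k + 1))"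
    by (subst binomial_fact) (simp_all add: algebra_simps)
  moreover have "Gamma (2 + real k) = fact (Suc k)"
    using Gamma_fact[of "Suc k", where 'a = real] by (simp add: add_ac)
  ultimately show ?thesis by (simp add: max_moment_def)
qed

text \<open>Consecutive values have the quotient (2k+3)/(2k+5), so they telescope; only quotients of
  Gamma values enter, never a value at a half-integer.\<close>

lemma max_moment_2: "max_moment 2 k = 1 / (2 * real k + 3)"
proof (induction k)
  case 0
  have "Gamma (3 / 2 + 1 :: real) = 3 / 2 * Gamma (3 / 2)"
    by (rule Gamma_plus1_pos) simp
  moreover have "Gamma (5 / 2 :: real) \<noteq> 0"
    using Gamma_real_pos[of "5 / 2"] by (metis less_irrefl zero_less_divide_iff zero_less_numeral)
  ultimately show ?case by (simp add: max_moment_def add.commute)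
next
  case (Suc k)
  define a where "a = real k + 1 + (real 2 + 1) / 2"
  have a: "a > 0" "2 * a = 2 * real k + 5" by (simp_all add: a_def)
  have e: "real (Suc k) + 1 + (real 2 + 1) / 2 = a + 1" by (simp add: a_def)
  have "max_moment 2 (Suc k) = max_moment 2 k * ((2 * real k + 3) / (2 * a))"
  proof -
    have "fact (2 * Suc k + 1) = (2 * real k + 3) * (2 * (real k + 1)) * (fact (2 * k + 1) :: real)"
      by (simp add: algebra_simps)
    moreover have "Gamma a > 0" using a by (intro Gamma_real_pos)
    ultimately show ?thesis
      unfolding max_moment_def e a_def[symmetric] Gamma_plus1_pos[OF a(1)] using a(1)
      by (simp add: divide_simps)
  qed
  then show ?case unfolding Suc a(2) by simp
qed

section \<open>Discretising the telegraph path\<close>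

definition direction :: "bool \<Rightarrow> real" where
  "direction u = (if u then 1 else - 1)"

text \<open>\<open>path_max\<close> recurses on the first step, whereas the telegraph path is
  compared with the walk forwards in time, one cell after another; this sum allows both views. Step
  \<open>j\<close> sees only the entries before it.\<close>

definition walk :: "bool \<Rightarrow> bool list \<Rightarrow> nat \<Rightarrow> real" where
  "walk u bs i = (\<Sum>j<i. direction u * (- 1) ^ count_list (take j bs) True)"

lemma walk_0 [simp]: "walk u bs 0 = 0"
  by (simp add: walk_def)

lemma walk_Cons_Suc: "walk u (b # bs) (Suc i) = direction u + walk (u \<noteq> b) bs i"
  unfolding walk_def sum.lessThan_Suc_shift
  by (simp add: direction_def sum_negf)

lemma walk_Suc:
  "walk u bs (Suc i) = walk u bs i + direction u * (- 1) ^ count_list (take i bs) True"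
  by (simp add: walk_def)

lemma walk_le_path_max: "i \<le> length bs \<Longrightarrow> walk u bs i \<le> real (path_max u bs)"
proof (induction bs arbitrary: u i)
  case (Cons b bs)
  show ?case
  proof (cases i)
    case (Suc i')
    then have "walk (u \<noteq> b) bs i' \<le> real (path_max (u \<noteq> b) bs)" using Cons by simp
    then show ?thesis unfolding Suc walk_Cons_Suc by (cases u) (auto simp: direction_def)
  qed simp
qed simp

text \<open>With \<open>walk_le_path_max\<close> this identifies \<open>path_max\<close> as the
  maximum of the walk. If it is positive, the truncated subtraction is exact; if it is 0, time 0
  attains it.\<close>

lemma path_max_eq_walk: "\<exists>i\<le>length bs. walk u bs i = real (path_max u bs)"
proof (induction bs arbitrary: u)
  case (Cons b bs)
  show ?case
  proof (cases "path_max u (b # bs) = 0")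
    case False
    obtain i where "i \<le> length bs" "walk (u \<noteq> b) bs i = real (path_max (u \<noteq> b) bs)"
      using Cons by blast
    then have "Suc i \<le> length (b # bs)" "walk u (b # bs) (Suc i) = real (path_max u (b # bs))"
      using False unfolding walk_Cons_Suc by (cases u; auto simp: direction_def)+
    then show ?thesis by blast
  qed (auto intro: exI[of _ 0])
qed simp

lemma count_list_eq_sum: "count_list bs True = (\<Sum>i<length bs. of_bool (bs ! i))"
proof (induction bs)
  case (Cons b bs)
  then show ?case by (simp only: length_Cons sum.lessThan_Suc_shift) simp
qed simp

context poisson_process
begin

definition cell_count :: "real \<Rightarrow> nat \<Rightarrow> 'a \<Rightarrow> nat" where
  "cell_count h i \<omega> = N (h * real (Suc i)) \<omega> - N (h * real i) \<omega>"

text \<open>Recording the parity, rather than whether the cell has a jump, makes the signs at the grid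
  points exact for every path, including cells with several jumps.\<close>

definition flips :: "real \<Rightarrow> nat \<Rightarrow> 'a \<Rightarrow> bool list" where
  "flips h L \<omega> = map (\<lambda>i. odd (cell_count h i \<omega>)) [0..<L]"

lemma length_flips [simp]: "length (flips h L \<omega>) = L"
  by (simp add: flips_def)

lemma N_Suc_cell:
  assumes "\<omega> \<in> space M" "h \<ge> 0"
  shows "N (h * real (Suc i)) \<omega> = N (h * real i) \<omega> + cell_count h i \<omega>"
  using N_mono[OF assms(1), of "h * real i" "h * real (Suc i)"] assms(2)
  by (simp add: cell_count_def mult_left_mono)

lemma N_eq_sum_cells:
  assumes "\<omega> \<in> space M" "h \<ge> 0"
  shows "N (h * real i) \<omega> = (\<Sum>j<i. cell_count h j \<omega>)"
proof (induction i)
  case (Suc i)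
  then show ?case unfolding N_Suc_cell[OF assms] by simp
qed (use N_zero[OF assms(1)] in simp)

lemma even_count_flips:
  assumes "\<omega> \<in> space M" "h \<ge> 0" "i \<le> L"
  shows "even (count_list (take i (flips h L \<omega>)) True) \<longleftrightarrow> even (N (h * real i) \<omega>)"
  using assms(3)
proof (induction i)
  case (Suc i)
  then show ?case
    unfolding N_Suc_cell[OF assms(1,2)] by (auto simp: take_Suc_conv_app_nth flips_def)
qed (use N_zero[OF assms(1)] in simp)

lemma telegraph_diff:
  fixes V0 :: "'a \<Rightarrow> real"
  assumes "\<omega> \<in> space M" "0 \<le> a" "a \<le> b"
  shows "telegraph V0 N b \<omega> - telegraph V0 N a \<omega> = integral {a..b} (\<lambda>s. V0 \<omega> * (-1) ^ N s \<omega>)"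
  using Henstock_Kurzweil_Integration.integral_combine[OF assms(2,3) telegraph_integrable[OF assms(1), of V0]]
  unfolding telegraph_def by simp

lemma telegraph_integrable_Icc:
  fixes V0 :: "'a \<Rightarrow> real"
  assumes "\<omega> \<in> space M" "0 \<le> a"
  shows "(\<lambda>s. V0 \<omega> * (-1) ^ N s \<omega>) integrable_on {a..b}"
  by (rule integrable_subinterval_real[OF telegraph_integrable[OF assms(1), of V0 b]])
    (use assms in auto)

lemma telegraph_lipschitz:
  fixes V0 :: "'a \<Rightarrow> real"
  assumes "\<omega> \<in> space M" "0 \<le> a" "a \<le> b" "V0 \<omega> = c" "c \<ge> 0"
  shows "\<bar>telegraph V0 N b \<omega> - telegraph V0 N a \<omega>\<bar> \<le> c * (b - a)"
proof -
  have "norm (integral {a..b} (\<lambda>s. V0 \<omega> * (-1) ^ N s \<omega>)) \<le> integral {a..b} (\<lambda>s. c)"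
    by (rule integral_norm_bound_integral[OF telegraph_integrable_Icc])
      (use assms in \<open>auto simp: abs_mult\<close>)
  then show ?thesis using assms by (simp add: telegraph_diff mult.commute)
qed

text \<open>A cell without jumps is exact. In a cell with jumps the increment and its prediction are
  each at most \<open>c * h\<close> in absolute value, and the error is charged to the jumps, of
  which there is at least one.\<close>

lemma telegraph_cell:
  fixes V0 :: "'a \<Rightarrow> real"
  assumes "\<omega> \<in> space M" "h \<ge> 0" "V0 \<omega> = c" "c \<ge> 0"
  shows "\<bar>telegraph V0 N (h * real (Suc i)) \<omega> - telegraph V0 N (h * real i) \<omega> -
      c * h * (-1) ^ N (h * real i) \<omega>\<bar> \<le> 2 * c * h * real (cell_count h i \<omega>)"
proof (cases "cell_count h i \<omega> = 0")
  case True
  have le: "h * real i \<le> h * real (Suc i)" using assms(2) by (simp add: mult_left_mono)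
  have const: "N s \<omega> = N (h * real i) \<omega>" if "h * real i \<le> s" "s \<le> h * real (Suc i)" for s
  proof -
    have "0 \<le> h * real i" using assms(2) by simp
    then have "N (h * real i) \<omega> \<le> N s \<omega>" "N s \<omega> \<le> N (h * real (Suc i)) \<omega>"
      using N_mono[OF assms(1) _ that(1)] N_mono[OF assms(1) _ that(2)] that(1) by auto
    then show ?thesis using N_Suc_cell[OF assms(1,2), of i] True by linarith
  qed
  have "integral {h * real i..h * real (Suc i)} (\<lambda>s. V0 \<omega> * (-1) ^ N s \<omega>) =
      integral {h * real i..h * real (Suc i)} (\<lambda>s. c * (-1) ^ N (h * real i) \<omega>)"
  proof (rule Henstock_Kurzweil_Integration.integral_cong)
    fix s assume "s \<in> {h * real i..h * real (Suc i)}"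
    then have "N s \<omega> = N (h * real i) \<omega>" by (intro const) auto
    then show "V0 \<omega> * (-1) ^ N s \<omega> = c * (-1) ^ N (h * real i) \<omega>" using assms(3) by simp
  qed
  also have "\<dots> = c * h * (-1) ^ N (h * real i) \<omega>"
    using le by (simp add: algebra_simps)
  finally show ?thesis
    using telegraph_diff[OF assms(1) _ le, of V0] assms True by simp
next
  case False
  have "\<bar>telegraph V0 N (h * real (Suc i)) \<omega> - telegraph V0 N (h * real i) \<omega>\<bar> \<le>
      c * (h * real (Suc i) - h * real i)"
    by (rule telegraph_lipschitz) (use assms in \<open>auto intro: mult_left_mono\<close>)
  then have "\<bar>telegraph V0 N (h * real (Suc i)) \<omega> - telegraph V0 N (h * real i) \<omega>\<bar> \<le> c * h"
    by (simp add: algebra_simps)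
  moreover have "\<bar>c * h * (-1) ^ N (h * real i) \<omega>\<bar> \<le> c * h"
    using assms by (simp add: abs_mult)
  moreover have "2 * c * h * 1 \<le> 2 * c * h * real (cell_count h i \<omega>)"
    using assms False by (intro mult_left_mono) auto
  ultimately show ?thesis by linarith
qed

text \<open>Since cell errors are charged to jumps, they add up to the number of jumps so far,
  however many cells there are.\<close>

lemma telegraph_walk:
  fixes V0 :: "'a \<Rightarrow> real"
  assumes "\<omega> \<in> space M" "h \<ge> 0" "V0 \<omega> = c" "c \<ge> 0" "i \<le> L"
  shows "\<bar>telegraph V0 N (h * real i) \<omega> - c * h * walk True (flips h L \<omega>) i\<bar> \<le>
    2 * c * h * real (N (h * real i) \<omega>)"
  using assms(5)
proof (induction i)
  case 0
  then show ?case using N_zero[OF assms(1)] by (simp add: telegraph_def)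
next
  case (Suc i)
  have "(-1) ^ count_list (take i (flips h L \<omega>)) True = ((-1) ^ N (h * real i) \<omega> :: real)"
    using even_count_flips[OF assms(1,2), of i L] Suc.prems by (auto simp: minus_one_power_iff)
  then have "c * h * walk True (flips h L \<omega>) (Suc i) =
      c * h * walk True (flips h L \<omega>) i + c * h * (-1) ^ N (h * real i) \<omega>"
    by (simp add: walk_Suc direction_def algebra_simps)
  moreover have "2 * c * h * real (N (h * real (Suc i)) \<omega>) =
      2 * c * h * real (N (h * real i) \<omega>) + 2 * c * h * real (cell_count h i \<omega>)"
    unfolding N_Suc_cell[OF assms(1,2)] by (simp add: algebra_simps)
  ultimately show ?case
    using Suc telegraph_cell[where ?V0.0 = V0 and \<omega> = \<omega>, OF assms(1-4), of i] by linarith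
qed

text \<open>A pathwise bound: \<open>2 * N t\<close> stems from the accumulated grid error,
  \<open>+ 1\<close> from the distance of a maximiser to the grid point on its left. Once
  \<open>N t\<close> is fixed, it is of order 1/L.\<close>

lemma running_max_path_max:
  fixes V0 :: "'a \<Rightarrow> real"
  assumes "\<omega> \<in> space M" "t > 0" "L > 0" "V0 \<omega> = c" "c \<ge> 0"
  shows "\<bar>running_max (telegraph V0 N) t \<omega> -
      c * t * (real (path_max True (flips (t / real L) L \<omega>)) / real L)\<bar> \<le>
    c * t * (2 * real (N t \<omega>) + 1) / real L"
proof -
  define h where "h = t / real L"
  define bs where "bs = flips h L \<omega>"
  have h: "h > 0" "h * real L = t" using assms by (simp_all add: h_def)
  have grid: "0 \<le> h * real i" "h * real i \<le> t" if "i \<le> L" for i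
    using that h by (auto simp flip: h(2))
  have near: "\<bar>telegraph V0 N (h * real i) \<omega> - c * h * walk True bs i\<bar> \<le> 2 * c * h * real (N t \<omega>)"
    if "i \<le> L" for i
  proof -
    have "2 * c * h * real (N (h * real i) \<omega>) \<le> 2 * c * h * real (N t \<omega>)"
      using N_mono[OF assms(1) grid[OF that]] assms h by (intro mult_left_mono) auto
    with telegraph_walk[where h = h and ?V0.0 = V0 and \<omega> = \<omega>, OF assms(1) _ assms(4,5) that] h show ?thesis
      unfolding bs_def by linarith
  qed
  obtain s where s: "s \<in> {0..t}" "telegraph V0 N s \<omega> = running_max (telegraph V0 N) t \<omega>"
    and s_max: "\<And>r. r \<in> {0..t} \<Longrightarrow> telegraph V0 N r \<omega> \<le> telegraph V0 N s \<omega>"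
    using telegraph_maximum_attained[OF assms(1), of t V0] assms(2) by auto
  have ch: "c * h \<ge> 0" using assms h by simp
  have upper: "telegraph V0 N s \<omega> \<le> c * h * real (path_max True bs) + 2 * c * h * real (N t \<omega>) + c * h"
  proof -
    define i where "i = nat \<lfloor>s / h\<rfloor>"
    have "0 \<le> s / h" using s h by simp
    then have "real i \<le> s / h" "s / h < real i + 1" by (auto simp: i_def)
    then have i: "h * real i \<le> s" "s \<le> h * real i + h" using h by (simp_all add: field_simps)
    then have "h * real i \<le> h * real L" using s h by simp
    then have "real i \<le> real L" unfolding mult_le_cancel_left_pos[OF h(1)] .
    then have iL: "i \<le> L" by simp
    have "\<bar>telegraph V0 N s \<omega> - telegraph V0 N (h * real i) \<omega>\<bar> \<le> c * (s - h * real i)"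
      by (rule telegraph_lipschitz) (use assms i grid[OF iL] in auto)
    also have "\<dots> \<le> c * h" using i assms by (intro mult_left_mono) auto
    finally have "telegraph V0 N s \<omega> \<le> telegraph V0 N (h * real i) \<omega> + c * h" by linarith
    moreover have "c * h * walk True bs i \<le> c * h * real (path_max True bs)"
      using walk_le_path_max[of i bs True] iL ch by (intro mult_left_mono) (auto simp: bs_def)
    ultimately show ?thesis using near[OF iL] by linarith
  qed
  have lower: "c * h * real (path_max True bs) \<le> telegraph V0 N s \<omega> + 2 * c * h * real (N t \<omega>)"
  proof -
    obtain i where i: "i \<le> L" "walk True bs i = real (path_max True bs)"
      using path_max_eq_walk[of bs True] by (auto simp: bs_def)
    with near[OF i(1)] s_max[of "h * real i"] grid[OF i(1)] show ?thesis by auto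
  qed
  have "c * t * (2 * real (N t \<omega>) + 1) / real L = 2 * c * h * real (N t \<omega>) + c * h"
    by (simp add: h_def algebra_simps add_divide_distrib)
  moreover have "c * t * (real (path_max True bs) / real L) = c * h * real (path_max True bs)"
    by (simp add: h_def)
  ultimately show ?thesis
    using upper lower s(2) ch unfolding h_def[symmetric] bs_def[symmetric] by linarith
qed

end

section \<open>The law of the jump pattern\<close>

text \<open>The left side is the Poisson probability of at least two jumps; the bound follows from
  exp(-\<mu>) \<ge> 1 - \<mu>.\<close>

lemma poisson_two_or_more:
  fixes \<mu> :: real
  assumes "\<mu> \<ge> 0"
  shows "1 - exp (- \<mu>) - \<mu> * exp (- \<mu>) \<le> \<mu>\<^sup>2"
proof -
  have "(1 + \<mu>) * (1 - \<mu>) \<le> (1 + \<mu>) * exp (- \<mu>)"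
    using assms exp_ge_add_one_self[of "- \<mu>"] by (intro mult_left_mono) auto
  then show ?thesis by (simp add: algebra_simps power2_eq_square)
qed

context poisson_process
begin

text \<open>The sigma-algebra of the counts in \<open>indep_V0_N\<close>. To be independent of
  \<open>V0\<close>, events about cells must be measurable for it and not only for
  \<open>M\<close>.\<close>

definition count_algebra :: "'a measure" where
  "count_algebra = vimage_algebra (space M) (\<lambda>\<omega>. \<lambda>s\<in>{0..}. N s \<omega>)
     (\<Pi>\<^sub>M s\<in>{0::real..}. count_space (UNIV :: nat set))"

lemma space_count_algebra [simp]: "space count_algebra = space M"
  by (simp add: count_algebra_def)

lemma measurable_N_count_algebra:
  assumes "s \<ge> 0"
  shows "N s \<in> measurable count_algebra (count_space UNIV)"
proof -
  have "(\<lambda>\<omega>. (\<lambda>s\<in>{0..}. N s \<omega>) s) \<in> measurable count_algebra (count_space UNIV)"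
    unfolding count_algebra_def
    by (rule measurable_compose[OF measurable_vimage_algebra1 measurable_component_singleton])
      (use assms in \<open>auto simp: space_PiM PiE_iff extensional_def\<close>)
  with assms show ?thesis by simp
qed

lemma measurable_cell_count:
  assumes "h \<ge> 0"
  shows "cell_count h i \<in> measurable count_algebra (count_space UNIV)"
    and "cell_count h i \<in> measurable M (count_space UNIV)"
proof -
  have nn: "0 \<le> h * real j" for j using assms by simp
  note [measurable] = measurable_N_count_algebra[OF nn] random_variable_N[OF nn]
  show "cell_count h i \<in> measurable count_algebra (count_space UNIV)"
    unfolding cell_count_def[abs_def] by measurable
  show "cell_count h i \<in> measurable M (count_space UNIV)"
    unfolding cell_count_def[abs_def] by measurable
qed

lemma flips_eq_list_iff:
  "flips h L \<omega> = bs \<longleftrightarrow> length bs = L \<and> (\<forall>i<L. odd (cell_count h i \<omega>) = bs ! i)"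
  unfolding list_eq_iff_nth_eq[of "flips h L \<omega>"] by (auto simp: flips_def)

lemma measurable_flips:
  assumes "h \<ge> 0"
  shows "flips h L \<in> measurable M (count_space UNIV)"
  unfolding measurable_count_space_eq2_countable
proof (intro conjI ballI)
  note [measurable] = measurable_cell_count(2)[OF assms]
  fix bs :: "bool list"
  have "flips h L -` {bs} \<inter> space M =
      (if length bs = L then {\<omega> \<in> space M. \<forall>i<L. odd (cell_count h i \<omega>) = bs ! i} else {})"
    by (auto simp: flips_eq_list_iff)
  also have "\<dots> \<in> events"
    by (cases "length bs = L"; simp only: if_True if_False simp_thms; measurable)
  finally show "flips h L -` {bs} \<inter> space M \<in> events" .
qed auto

lemma prob_increment:
  assumes "0 \<le> r" "r < s"
  shows "prob {\<omega> \<in> space M. N s \<omega> - N r \<omega> = k} =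
    (rate * (s - r)) ^ k / fact k * exp (- (rate * (s - r)))"
proof -
  have [measurable]: "N s \<in> measurable M (count_space UNIV)" "N r \<in> measurable M (count_space UNIV)"
    using assms by (auto intro: random_variable_N)
  have "prob {\<omega> \<in> space M. N s \<omega> - N r \<omega> = k} =
      measure (distr M (count_space UNIV) (\<lambda>\<omega>. N s \<omega> - N r \<omega>)) {k}"
    by (subst measure_distr) (auto intro!: arg_cong[where f = prob])
  also have "\<dots> = pmf (poisson_pmf (rate * (s - r))) k"
    unfolding poisson_increments[OF assms] by (simp add: measure_pmf_single)
  also have "\<dots> = (rate * (s - r)) ^ k / fact k * exp (- (rate * (s - r)))"
    using assms rate_pos by (subst pmf_poisson) auto
  finally show ?thesis .
qed

lemma prob_N_eq:
  assumes "t > 0"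
  shows "prob {\<omega> \<in> space M. N t \<omega> = n} = (rate * t) ^ n / fact n * exp (- (rate * t))"
proof -
  have "{\<omega> \<in> space M. N t \<omega> = n} = {\<omega> \<in> space M. N t \<omega> - N 0 \<omega> = n}"
    using N_zero by auto
  then show ?thesis using prob_increment[of 0 t n] assms by simp
qed

lemma prob_cell_count:
  assumes "h > 0"
  shows "prob {\<omega> \<in> space M. cell_count h i \<omega> = k} =
    (rate * h) ^ k / fact k * exp (- (rate * h))"
  using prob_increment[of "h * real i" "h * real (Suc i)" k] assms
  by (simp add: cell_count_def algebra_simps)

lemma prob_cell_counts:
  assumes "h > 0" "L > 0"
  shows "prob {\<omega> \<in> space M. \<forall>i<L. cell_count h i \<omega> = k i} =
    (\<Prod>i<L. (rate * h) ^ k i / fact (k i) * exp (- (rate * h)))"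
proof -
  have "indep_vars (\<lambda>_. count_space UNIV) (\<lambda>i. cell_count h i) {..<L}"
    unfolding cell_count_def[abs_def]
    by (rule independent_increments[of "\<lambda>i. h * real i"]) (use assms in \<open>auto intro: mult_left_mono\<close>)
  then have "prob (\<Inter>i\<in>{..<L}. cell_count h i -` {k i} \<inter> space M) =
      (\<Prod>i<L. prob (cell_count h i -` {k i} \<inter> space M))"
    by (rule indep_varsD) (use assms in auto)
  moreover have "(\<Inter>i\<in>{..<L}. cell_count h i -` {k i} \<inter> space M) =
      {\<omega> \<in> space M. \<forall>i<L. cell_count h i \<omega> = k i}"
    using assms by auto
  moreover have "cell_count h i -` {k i} \<inter> space M = {\<omega> \<in> space M. cell_count h i \<omega> = k i}" for i
    by auto
  ultimately show ?thesis using prob_cell_count[OF assms(1)] by simp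
qed

text \<open>A union bound over the cells; for \<open>h = t / L\<close> it equals (rate t)^2 /
  L.\<close>

lemma prob_multiple_jump_cell:
  assumes "h > 0"
  shows "prob {\<omega> \<in> space M. \<exists>i<L. cell_count h i \<omega> \<ge> 2} \<le> real L * (rate * h)\<^sup>2"
proof -
  have h: "h \<ge> 0" using assms by simp
  note [measurable] = measurable_cell_count(2)[OF h]
  have one: "prob {\<omega> \<in> space M. cell_count h i \<omega> \<ge> 2} \<le> (rate * h)\<^sup>2" for i
  proof -
    have "prob (space M - {\<omega> \<in> space M. cell_count h i \<omega> = 0} -
        {\<omega> \<in> space M. cell_count h i \<omega> = 1}) =
        1 - prob {\<omega> \<in> space M. cell_count h i \<omega> = 0} - prob {\<omega> \<in> space M. cell_count h i \<omega> = 1}"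
      by (subst finite_measure_Diff; (subst prob_compl)?; auto)
    moreover have "space M - {\<omega> \<in> space M. cell_count h i \<omega> = 0} -
        {\<omega> \<in> space M. cell_count h i \<omega> = 1} = {\<omega> \<in> space M. cell_count h i \<omega> \<ge> 2}"
      by auto
    ultimately show ?thesis
      using poisson_two_or_more[of "rate * h"] prob_cell_count[OF assms, of i] assms rate_pos by simp
  qed
  have "{\<omega> \<in> space M. \<exists>i<L. cell_count h i \<omega> \<ge> 2} =
      (\<Union>i<L. {\<omega> \<in> space M. cell_count h i \<omega> \<ge> 2})" by auto
  then have "prob {\<omega> \<in> space M. \<exists>i<L. cell_count h i \<omega> \<ge> 2} \<le>
      (\<Sum>i<L. prob {\<omega> \<in> space M. cell_count h i \<omega> \<ge> 2})"
    by (simp only:) (rule finite_measure_subadditive_finite, auto)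
  also have "\<dots> \<le> (\<Sum>i<L. (rate * h)\<^sup>2)" by (intro sum_mono one)
  finally show ?thesis by simp
qed

text \<open>Independent increments apply to prescribed counts, while the walk is determined by
  parities. The two descriptions agree when no cell has two jumps, because a parity then fixes the
  count.\<close>

lemma flips_eq_iff:
  assumes "\<omega> \<in> space M" "bs \<in> flip_lists L n" "h \<ge> 0" "h * real L = t"
  shows "(\<forall>i<L. cell_count h i \<omega> = of_bool (bs ! i)) \<longleftrightarrow>
    N t \<omega> = n \<and> (\<forall>i<L. cell_count h i \<omega> < 2) \<and> flips h L \<omega> = bs"
proof -
  have len: "length bs = L" "count_list bs True = n" using assms(2) by (auto simp: flip_lists_def)
  have "N t \<omega> = (\<Sum>j<L. cell_count h j \<omega>)"
    using N_eq_sum_cells[OF assms(1,3), of L] assms(4) by simp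
  then have "N t \<omega> = n" if "\<forall>i<L. cell_count h i \<omega> = of_bool (bs ! i)"
    using that len by (auto simp: count_list_eq_sum)
  moreover have "m = of_bool b \<longleftrightarrow> m < 2 \<and> odd m = b" for m :: nat and b
    by (cases b) (auto simp: less_2_cases_iff)
  then have "(\<forall>i<L. cell_count h i \<omega> = of_bool (bs ! i)) \<longleftrightarrow>
      (\<forall>i<L. cell_count h i \<omega> < 2) \<and> (\<forall>i<L. odd (cell_count h i \<omega>) = bs ! i)"
    by blast
  moreover have "flips h L \<omega> = bs \<longleftrightarrow> (\<forall>i<L. odd (cell_count h i \<omega>) = bs ! i)"
    using len by (simp add: flips_eq_list_iff)
  ultimately show ?thesis by blast
qed

lemma flips_mem_flip_lists:
  assumes "\<omega> \<in> space M" "N t \<omega> = n" "\<forall>i<L. cell_count h i \<omega> < 2" "h \<ge> 0" "h * real L = t"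
  shows "flips h L \<omega> \<in> flip_lists L n"
proof -
  have "m = of_bool (odd m)" if "m < 2" for m :: nat
    using that by (auto simp: less_2_cases_iff)
  then have "(\<Sum>j<L. cell_count h j \<omega>) = (\<Sum>j<L. of_bool (flips h L \<omega> ! j))"
    using assms(3) by (intro sum.cong) (auto simp: flips_def)
  with N_eq_sum_cells[OF assms(1,4), of L] assms show ?thesis
    by (simp add: flip_lists_def count_list_eq_sum)
qed

end

section \<open>Expectations on the event that fixes the initial velocity and the number of
  jumps\<close>

context symmetric_telegraph
begin

lemma prob_V0_pos_and:
  assumes E: "{\<omega> \<in> space M. P \<omega>} \<in> sets count_algebra"
  shows "prob {\<omega> \<in> space M. V0 \<omega> = c \<and> P \<omega>} = prob {\<omega> \<in> space M. P \<omega>} / 2"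
proof -
  have "V0 -` {c} \<inter> space M \<in> sets (vimage_algebra (space M) V0 borel)"
    by (rule in_vimage_algebra) simp
  from indep_setD[OF indep_V0_N this E[unfolded count_algebra_def]]
  have "prob ((V0 -` {c} \<inter> space M) \<inter> {\<omega> \<in> space M. P \<omega>}) =
      prob (V0 -` {c} \<inter> space M) * prob {\<omega> \<in> space M. P \<omega>}" .
  moreover have "(V0 -` {c} \<inter> space M) \<inter> {\<omega> \<in> space M. P \<omega>} = {\<omega> \<in> space M. V0 \<omega> = c \<and> P \<omega>}"
    "V0 -` {c} \<inter> space M = {\<omega> \<in> space M. V0 \<omega> = c}" by auto
  ultimately show ?thesis using prob_V0_pos by simp
qed

lemma prob_event:
  assumes "t > 0"
  shows "prob {\<omega> \<in> space M. V0 \<omega> = c \<and> N t \<omega> = n} =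
    (rate * t) ^ n / fact n * exp (- (rate * t)) / 2"
proof -
  have [measurable]: "N t \<in> measurable count_algebra (count_space UNIV)"
    using assms by (intro measurable_N_count_algebra) simp
  have "{\<omega> \<in> space count_algebra. N t \<omega> = n} \<in> sets count_algebra" by measurable
  then show ?thesis using prob_V0_pos_and[of "\<lambda>\<omega>. N t \<omega> = n"] prob_N_eq[OF assms, of n] by simp
qed

text \<open>The value depends on the pattern only through its number of marks, which is the source
  of the uniform law. The exponentials of the \<open>L\<close> cells recombine to that of
  \<open>t\<close>.\<close>

lemma prob_flip_pattern:
  assumes "t > 0" "L > 0" "bs \<in> flip_lists L n"
  shows "prob {\<omega> \<in> space M. V0 \<omega> = c \<and> (\<forall>i<L. cell_count (t / real L) i \<omega> = of_bool (bs ! i))} =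
    (rate * t / real L) ^ n * exp (- (rate * t)) / 2"
proof -
  define h where "h = t / real L"
  have h: "h > 0" "h \<ge> 0" using assms by (simp_all add: h_def)
  note [measurable] = measurable_cell_count(1)[OF h(2)]
  have "{\<omega> \<in> space count_algebra. \<forall>i<L. cell_count h i \<omega> = of_bool (bs ! i)} \<in>
      sets count_algebra" by measurable
  then have E: "{\<omega> \<in> space M. \<forall>i<L. cell_count h i \<omega> = of_bool (bs ! i)} \<in> sets count_algebra"
    by (simp only: space_count_algebra)
  have "prob {\<omega> \<in> space M. V0 \<omega> = c \<and> (\<forall>i<L. cell_count h i \<omega> = of_bool (bs ! i))} =
      prob {\<omega> \<in> space M. \<forall>i<L. cell_count h i \<omega> = of_bool (bs ! i)} / 2"
    by (rule prob_V0_pos_and[OF E])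
  also have "prob {\<omega> \<in> space M. \<forall>i<L. cell_count h i \<omega> = of_bool (bs ! i)} =
      (\<Prod>i<L. (rate * h) ^ of_bool (bs ! i) * exp (- (rate * h)))"
    by (subst prob_cell_counts[OF h(1) assms(2)]) (rule prod.cong, auto simp: of_bool_def)
  also have "\<dots> = (rate * h) ^ n * exp (- (rate * h)) ^ L"
    using assms(3)
    by (auto simp: prod.distrib power_sum[symmetric] flip_lists_def count_list_eq_sum)
  also have "exp (- (rate * h)) ^ L = exp (- (rate * t))"
    unfolding exp_of_nat_mult[symmetric] using assms by (simp add: h_def)
  finally show ?thesis by (simp add: h_def)
qed

text \<open>The lattice expectation is exact off the event that some cell has several jumps; on that
  event the integrand is at most \<open>(c * t) ^ m\<close>, and its probability gives the
  error.\<close>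

lemma path_moment_approx:
  fixes n m L :: nat
  assumes "t > 0" "L > 0"
  defines "A \<equiv> {\<omega> \<in> space M. V0 \<omega> = c \<and> N t \<omega> = n}"
    and "X \<equiv> \<lambda>\<omega>. (c * t * (real (path_max True (flips (t / real L) L \<omega>)) / real L)) ^ m"
  shows "\<bar>(LINT \<omega>:A|M. X \<omega>) - prob A * (c * t) ^ m * path_moment m n L\<bar> \<le>
    (c * t) ^ m * ((rate * t)\<^sup>2 / real L)"
proof -
  define h where "h = t / real L"
  have h: "h > 0" "h \<ge> 0" "h * real L = t" using assms by (simp_all add: h_def)
  note [measurable] = measurable_cell_count(2)[OF h(2)] measurable_flips[OF h(2)]
    random_variable_V0
  have [measurable]: "N t \<in> measurable M (count_space UNIV)"
    using assms by (intro random_variable_N) simp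
  have A [measurable]: "A \<in> events" unfolding A_def by measurable
  define B where "B bs = {\<omega> \<in> space M. V0 \<omega> = c \<and> (\<forall>i<L. cell_count h i \<omega> = of_bool (bs ! i))}"
    for bs :: "bool list"
  have B [measurable]: "B bs \<in> events" for bs unfolding B_def by measurable
  define D where "D = {\<omega> \<in> space M. \<exists>i<L. cell_count h i \<omega> \<ge> 2}"
  have D [measurable]: "D \<in> events" unfolding D_def by measurable
  define x where "x bs = (c * t * (real (path_max True bs) / real L)) ^ m" for bs
  have X: "X \<omega> = x (flips h L \<omega>)" for \<omega> by (simp add: X_def x_def h_def)
  have X_meas [measurable]: "X \<in> borel_measurable M" unfolding X by measurable
  have x_bound: "0 \<le> x bs" "x bs \<le> (c * t) ^ m" if "length bs = L" for bs
  proof -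
    have "real (path_max True bs) / real L \<le> 1"
      using path_max_le_length[of True bs] that assms by simp
    then have "c * t * (real (path_max True bs) / real L) \<le> c * t * 1"
      using c_pos assms by (intro mult_left_mono) auto
    then show "x bs \<le> (c * t) ^ m" "0 \<le> x bs"
      using c_pos assms by (auto simp: x_def intro!: power_mono)
  qed
  \<comment> \<open>As a sum over patterns \<open>Y\<close> has a computable integral; it is also
    \<open>X\<close> restricted to \<open>A\<close> outside \<open>D\<close>.\<close>
  define Y where "Y \<omega> = (\<Sum>bs\<in>flip_lists L n. x bs * indicator (B bs) \<omega>)" for \<omega>
  have Y: "Y \<omega> = (if \<omega> \<in> A \<and> \<omega> \<notin> D then X \<omega> else 0)" if "\<omega> \<in> space M" for \<omega>
  proof -
    have mem: "\<omega> \<in> B bs \<longleftrightarrow> \<omega> \<in> A \<and> \<omega> \<notin> D \<and> flips h L \<omega> = bs" if "bs \<in> flip_lists L n" for bs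
      using flips_eq_iff[OF \<open>\<omega> \<in> space M\<close> that h(2,3)] \<open>\<omega> \<in> space M\<close>
      by (auto simp: A_def B_def D_def not_le)
    show ?thesis
    proof (cases "\<omega> \<in> A \<and> \<omega> \<notin> D")
      case True
      have "Y \<omega> = (\<Sum>bs\<in>flip_lists L n. if flips h L \<omega> = bs then x bs else 0)"
        unfolding Y_def by (rule sum.cong) (use mem True in \<open>auto simp: indicator_def\<close>)
      moreover have "flips h L \<omega> \<in> flip_lists L n"
        by (rule flips_mem_flip_lists[OF that _ _ h(2,3)])
          (use True in \<open>auto simp: A_def D_def not_le\<close>)
      ultimately show ?thesis using True by (simp add: X)
    next
      case False
      then show ?thesis unfolding Y_def by (auto intro!: sum.neutral simp: mem)
    qed
  qed
  have intY: "integrable M Y"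
    unfolding Y_def by (intro Bochner_Integration.integrable_sum integrable_mult_right integrable_real_indicator)
      (auto simp: emeasure_eq_measure)
  have intX: "integrable M (\<lambda>\<omega>. indicator A \<omega> * X \<omega>)"
    by (rule integrable_const_bound[where B = "(c * t) ^ m"])
      (use x_bound c_pos assms(1) in \<open>auto simp: indicator_def X intro!: AE_I2\<close>)
  have "(\<integral>\<omega>. Y \<omega> \<partial>M) = (\<Sum>bs\<in>flip_lists L n. x bs * prob (B bs))"
    unfolding Y_def
    by (subst Bochner_Integration.integral_sum)
      (auto intro!: integrable_mult_right integrable_real_indicator simp: emeasure_eq_measure)
  also have "\<dots> = (\<Sum>bs\<in>flip_lists L n. x bs * ((rate * t / real L) ^ n * exp (- (rate * t)) / 2))"
    using prob_flip_pattern[OF assms(1,2)] by (intro sum.cong) (auto simp: B_def h_def)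
  \<comment> \<open>The \<open>fact n\<close> in \<open>path_moment\<close> cancels the 1/n! of the
    Poisson weight in \<open>prob A\<close>, which the pattern probabilities lack.\<close>
  also have "\<dots> = prob A * (c * t) ^ m * path_moment m n L"
    unfolding A_def prob_event[OF assms(1)] path_moment_def x_def power_mult_distrib[of "c * t"]
    by (simp add: sum_distrib_left sum_distrib_right power_divide power_mult_distrib field_simps)
  finally have EY: "(\<integral>\<omega>. Y \<omega> \<partial>M) = prob A * (c * t) ^ m * path_moment m n L" .
  have "\<bar>(\<integral>\<omega>. indicator A \<omega> * X \<omega> \<partial>M) - (\<integral>\<omega>. Y \<omega> \<partial>M)\<bar> =
      \<bar>\<integral>\<omega>. indicator A \<omega> * X \<omega> - Y \<omega> \<partial>M\<bar>"
    by (subst Bochner_Integration.integral_diff[OF intX intY]) simp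
  also have "\<dots> \<le> (\<integral>\<omega>. \<bar>indicator A \<omega> * X \<omega> - Y \<omega>\<bar> \<partial>M)"
    by (rule integral_abs_bound)
  also have "\<dots> \<le> (\<integral>\<omega>. (c * t) ^ m * indicator D \<omega> \<partial>M)"
  proof (rule integral_mono)
    show "integrable M (\<lambda>\<omega>. \<bar>indicator A \<omega> * X \<omega> - Y \<omega>\<bar>)"
      by (intro integrable_abs Bochner_Integration.integrable_diff intX intY)
    show "integrable M (\<lambda>\<omega>. (c * t) ^ m * indicator D \<omega>)"
      by (intro integrable_mult_right integrable_real_indicator) (auto simp: emeasure_eq_measure)
    fix \<omega> assume "\<omega> \<in> space M"
    then show "\<bar>indicator A \<omega> * X \<omega> - Y \<omega>\<bar> \<le> (c * t) ^ m * indicator D \<omega>"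
      using Y[of \<omega>] x_bound[of "flips h L \<omega>"] c_pos assms(1) by (auto simp: indicator_def X)
  qed
  also have "\<dots> = (c * t) ^ m * prob D" by simp
  also have "\<dots> \<le> (c * t) ^ m * ((rate * t)\<^sup>2 / real L)"
  proof (rule mult_left_mono)
    have "real L * (rate * h)\<^sup>2 = (rate * t)\<^sup>2 / real L"
      using assms by (simp add: h_def power2_eq_square)
    with prob_multiple_jump_cell[OF h(1), of L] show "prob D \<le> (rate * t)\<^sup>2 / real L"
      by (simp add: D_def)
  qed (use c_pos assms(1) in simp)
  finally show ?thesis unfolding EY set_lebesgue_integral_def by simp
qed

text \<open>Dominated convergence along even \<open>L\<close>: the lattice maxima converge to the
  running maximum at every outcome of the event, and \<open>path_moment_approx\<close> identifies
  the limit of their integrals.\<close>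

lemma event_expectation_running_max_power:
  assumes "t > 0" and lim: "(\<lambda>r. path_moment m n (2 * r)) \<longlonglongrightarrow> l"
  shows "event_expectation M (\<lambda>\<omega>. running_max (telegraph V0 N) t \<omega> ^ m)
      (\<lambda>\<omega>. V0 \<omega> = c \<and> N t \<omega> = n) = (c * t) ^ m * l"
proof -
  define A where "A = {\<omega> \<in> space M. V0 \<omega> = c \<and> N t \<omega> = n}"
  define G where "G L \<omega> = c * t * (real (path_max True (flips (t / real L) L \<omega>)) / real L)"
    for L \<omega>
  note [measurable] = random_variable_V0
  have [measurable]: "N t \<in> measurable M (count_space UNIV)"
    using assms by (intro random_variable_N) simp
  have A [measurable]: "A \<in> events" unfolding A_def by measurable
  have [measurable]: "flips (t / real L) L \<in> measurable M (count_space UNIV)" for L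
    using assms by (intro measurable_flips) simp
  have [measurable]: "G L \<in> borel_measurable M" for L unfolding G_def[abs_def] by measurable
  \<comment> \<open>\<open>2 * Suc r\<close> keeps the number of cells even and positive; it equals
    \<open>Suc (2 * r + 1)\<close>, hence the subsequence.\<close>
  have inv_lim: "(\<lambda>r. K / real (2 * Suc r)) \<longlonglongrightarrow> 0" for K :: real
    using LIMSEQ_subseq_LIMSEQ[OF LIMSEQ_Suc[OF lim_const_over_n[of K]], of "\<lambda>r. 2 * r + 1"]
    by (simp add: o_def strict_mono_def)
  have G_lim: "(\<lambda>r. G (2 * Suc r) \<omega>) \<longlonglongrightarrow> running_max (telegraph V0 N) t \<omega>" if "\<omega> \<in> A" for \<omega>
  proof (rule Lim_null[THEN iffD2], rule Lim_null_comparison[OF _ inv_lim])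
    show "\<forall>\<^sub>F r in sequentially. norm (G (2 * Suc r) \<omega> - running_max (telegraph V0 N) t \<omega>) \<le>
        c * t * (2 * real (N t \<omega>) + 1) / real (2 * Suc r)"
    proof (rule always_eventually, rule allI)
      fix r
      show "norm (G (2 * Suc r) \<omega> - running_max (telegraph V0 N) t \<omega>) \<le>
          c * t * (2 * real (N t \<omega>) + 1) / real (2 * Suc r)"
        unfolding G_def real_norm_def abs_minus_commute[of "c * t * _"]
        by (rule running_max_path_max) (use that assms(1) c_pos in \<open>auto simp: A_def\<close>)
    qed
  qed
  have ind_lim: "(\<lambda>r. indicator A \<omega> * G (2 * Suc r) \<omega> ^ m) \<longlonglongrightarrow>
      indicator A \<omega> * running_max (telegraph V0 N) t \<omega> ^ m" for \<omega>
  proof (cases "\<omega> \<in> A")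
    case True
    then show ?thesis using tendsto_power[OF G_lim[OF True], of m] by simp
  qed simp
  have "(\<lambda>r. \<integral>\<omega>. indicator A \<omega> * G (2 * Suc r) \<omega> ^ m \<partial>M) \<longlonglongrightarrow>
      (\<integral>\<omega>. indicator A \<omega> * running_max (telegraph V0 N) t \<omega> ^ m \<partial>M)"
  proof (rule integral_dominated_convergence[where w = "\<lambda>_. (c * t) ^ m"])
    \<comment> \<open>Measurability of the running maximum on the event is inherited from the
      lattice maxima.\<close>
    show "(\<lambda>\<omega>. indicator A \<omega> * running_max (telegraph V0 N) t \<omega> ^ m) \<in> borel_measurable M"
      by (rule borel_measurable_LIMSEQ_real[OF ind_lim]) measurable
    show "AE \<omega> in M. norm (indicator A \<omega> * G (2 * Suc r) \<omega> ^ m) \<le> (c * t) ^ m" for r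
    proof (rule AE_I2)
      fix \<omega>
      have "real (path_max True (flips (t / real (2 * Suc r)) (2 * Suc r) \<omega>)) / real (2 * Suc r) \<le> 1"
        using path_max_le_length[of True "flips (t / real (2 * Suc r)) (2 * Suc r) \<omega>"]
        unfolding length_flips by (subst divide_le_eq_1_pos) (auto simp del: of_nat_Suc)
      then have "G (2 * Suc r) \<omega> \<le> c * t * 1" unfolding G_def
        using c_pos assms by (intro mult_left_mono) auto
      moreover have "0 \<le> G (2 * Suc r) \<omega>" using c_pos assms by (simp add: G_def)
      ultimately have "0 \<le> G (2 * Suc r) \<omega> ^ m" "G (2 * Suc r) \<omega> ^ m \<le> (c * t) ^ m"
        by (auto intro: power_mono)
      then show "norm (indicator A \<omega> * G (2 * Suc r) \<omega> ^ m) \<le> (c * t) ^ m"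
        by (auto simp: indicator_def)
    qed
  qed (use ind_lim in auto)
  moreover have "(\<lambda>r. \<integral>\<omega>. indicator A \<omega> * G (2 * Suc r) \<omega> ^ m \<partial>M) \<longlonglongrightarrow>
      prob A * (c * t) ^ m * l"
  proof (rule Lim_transform2)
    show "(\<lambda>r. prob A * (c * t) ^ m * path_moment m n (2 * Suc r)) \<longlonglongrightarrow> prob A * (c * t) ^ m * l"
      by (intro tendsto_intros LIMSEQ_Suc[OF lim])
    show "(\<lambda>r. prob A * (c * t) ^ m * path_moment m n (2 * Suc r) -
        (\<integral>\<omega>. indicator A \<omega> * G (2 * Suc r) \<omega> ^ m \<partial>M)) \<longlonglongrightarrow> 0"
    proof (rule Lim_null_comparison[OF always_eventually inv_lim], rule allI)
      fix r
      show "norm (prob A * (c * t) ^ m * path_moment m n (2 * Suc r) -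
          (\<integral>\<omega>. indicator A \<omega> * G (2 * Suc r) \<omega> ^ m \<partial>M)) \<le>
          (c * t) ^ m * (rate * t)\<^sup>2 / real (2 * Suc r)"
        using path_moment_approx[OF assms(1), of "2 * Suc r" n m]
        unfolding A_def[symmetric] set_lebesgue_integral_def G_def
        by (simp only: real_norm_def abs_minus_commute) simp
    qed
  qed
  ultimately have "(\<integral>\<omega>. indicator A \<omega> * running_max (telegraph V0 N) t \<omega> ^ m \<partial>M) =
      prob A * (c * t) ^ m * l"
    by (rule LIMSEQ_unique)
  moreover have "prob A > 0"
    using prob_event[OF assms(1), of n] rate_pos assms(1) by (simp add: A_def)
  ultimately show ?thesis
    unfolding event_expectation_def A_def[symmetric] set_lebesgue_integral_def by simp
qed

end

theorem mainTheorem15: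
  fixes M :: "'a measure" and N :: "real \<Rightarrow> 'a \<Rightarrow> nat" and V0 :: "'a \<Rightarrow> real"
    and c rate t :: real
  assumes "symmetric_telegraph M rate N c V0"
    and "t > 0"
  shows "(\<forall>m k :: nat. m \<ge> 1 \<longrightarrow>
      event_expectation M (\<lambda>\<omega>. running_max (telegraph V0 N) t \<omega> ^ m)
          (\<lambda>\<omega>. V0 \<omega> = c \<and> N t \<omega> = 2 * k + 1)
        = event_expectation M (\<lambda>\<omega>. running_max (telegraph V0 N) t \<omega> ^ m)
            (\<lambda>\<omega>. V0 \<omega> = c \<and> N t \<omega> = 2 * k + 2)
    \<and> event_expectation M (\<lambda>\<omega>. running_max (telegraph V0 N) t \<omega> ^ m)
          (\<lambda>\<omega>. V0 \<omega> = c \<and> N t \<omega> = 2 * k + 2)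
        = fact (2 * k + 1) * (c * t) ^ m / (2 ^ (2 * k + 1) * fact k)
            * (Gamma ((real m + 1) / 2) / Gamma (real k + 1 + (real m + 1) / 2)))
    \<and> (\<forall>k :: nat.
      event_expectation M (\<lambda>\<omega>. running_max (telegraph V0 N) t \<omega>)
          (\<lambda>\<omega>. V0 \<omega> = c \<and> N t \<omega> = 2 * k + 1)
        = real ((2 * k + 1) choose k) * (c * t / 2 ^ (2 * k + 1))
    \<and> event_expectation M (\<lambda>\<omega>. (running_max (telegraph V0 N) t \<omega>)\<^sup>2)
          (\<lambda>\<omega>. V0 \<omega> = c \<and> N t \<omega> = 2 * k + 1)
        = c\<^sup>2 * t\<^sup>2 / (2 * real k + 3))"
proof -
  interpret symmetric_telegraph M rate N c V0 by (rule assms(1))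
  have odd: "event_expectation M (\<lambda>\<omega>. running_max (telegraph V0 N) t \<omega> ^ m)
      (\<lambda>\<omega>. V0 \<omega> = c \<and> N t \<omega> = 2 * k + 1) = (c * t) ^ m * max_moment m k" for m k
    by (rule event_expectation_running_max_power[OF assms(2) path_moment_odd_tendsto])
  have even: "event_expectation M (\<lambda>\<omega>. running_max (telegraph V0 N) t \<omega> ^ m)
      (\<lambda>\<omega>. V0 \<omega> = c \<and> N t \<omega> = 2 * k + 2) = (c * t) ^ m * max_moment m k" if "m \<ge> 1" for m k
    by (rule event_expectation_running_max_power[OF assms(2) path_moment_even_tendsto])
      (use that in simp)
  show ?thesis
  proof (intro conjI allI impI)
    fix m k :: nat assume m: "m \<ge> 1"
    show "event_expectation M (\<lambda>\<omega>. running_max (telegraph V0 N) t \<omega> ^ m)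
          (\<lambda>\<omega>. V0 \<omega> = c \<and> N t \<omega> = 2 * k + 1)
        = event_expectation M (\<lambda>\<omega>. running_max (telegraph V0 N) t \<omega> ^ m)
            (\<lambda>\<omega>. V0 \<omega> = c \<and> N t \<omega> = 2 * k + 2)"
      unfolding odd even[OF m] ..
    show "event_expectation M (\<lambda>\<omega>. running_max (telegraph V0 N) t \<omega> ^ m)
          (\<lambda>\<omega>. V0 \<omega> = c \<and> N t \<omega> = 2 * k + 2)
        = fact (2 * k + 1) * (c * t) ^ m / (2 ^ (2 * k + 1) * fact k)
            * (Gamma ((real m + 1) / 2) / Gamma (real k + 1 + (real m + 1) / 2))"
      unfolding even[OF m] max_moment_def by simp
  next
    fix k :: nat
    show "event_expectation M (\<lambda>\<omega>. running_max (telegraph V0 N) t \<omega>)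
          (\<lambda>\<omega>. V0 \<omega> = c \<and> N t \<omega> = 2 * k + 1)
        = real ((2 * k + 1) choose k) * (c * t / 2 ^ (2 * k + 1))"
      using odd[of 1 k] unfolding max_moment_1 by simp
    show "event_expectation M (\<lambda>\<omega>. (running_max (telegraph V0 N) t \<omega>)\<^sup>2)
          (\<lambda>\<omega>. V0 \<omega> = c \<and> N t \<omega> = 2 * k + 1)
        = c\<^sup>2 * t\<^sup>2 / (2 * real k + 3)"
      using odd[of 2 k] unfolding max_moment_2 by (simp add: power_mult_distrib)
  qed
qed

end
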